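(* Let $\mathcal{X}$ be a separable metric space with its Borel $\sigma$-field, let $(\mathcal{X},\mathcal{A},L)$ be a basic game, and let $\Omega\subseteq\Theta$ be a nonempty statistical model, with associated set $\Delta$ of priors on $\Omega$ and set of mixtures $\Gamma=\{P_\Pi:\Pi\in\Delta\}$. Suppose: (1) whenever $(Q_n)$ is a sequence of distributions in $\Gamma$, with respective Bayes acts $(\zeta_n)$ (in the basic game), such that $(H(Q_n))$ is bounded below and $(Q_n)$ converges weakly to some $Q_0\in\mathcal{P}_0$, then $Q_0\in\mathcal{P}$, $Q_0$ has a Bayes act $\zeta_0$ and, for some choice of the Bayes acts $(\zeta_n)$ and $\zeta_0$, $L(P,\zeta_0)\le\liminf_{n\to\infty}L(P,\zeta_n)$ for all $P\in\Gamma$; (2) $\Gamma$ is convex; every $P\in\Gamma$ has a Bayes act and finite entropy $H(P)$; and $H^*:=\sup_{P\in\Gamma}H(P)<\infty$; (3) there exists $K\in\mathbb{R}$ such that $H(P_\omega)\ge K$ for all $\omega\in\Omega$; (4) the statistical model $\Omega$ is tight. Then $\widehat{H}^*:=\sup_{\Pi\in\Delta}\widehat{H}(\Pi)$ is finite, the game $\widehat{\mathcal{G}}^\Omega$ has value $\widehat{H}^*$, and there exists a minimax (robust Bayes) act $\widehat{\zeta}^*\in\mathcal{Z}$ in $\widehat{\mathcal{G}}^\Omega$ such that $$\sup_{\omega\in\Omega}\widehat{L}(\omega,\widehat{\zeta}^* )=\inf_{\zeta\in\mathcal{Z}}\sup_{\omega\in\Omega}\widehat{L}(\omega,\zeta)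=\sup_{\Pi\in\Delta}\inf_{a\in\mathcal{A}}\widehat{L}(\Pi,a)=\widehat{H}^*.$$
   Context: A basic game $(\mathcal{X},\mathcal{A},L)$ consists of measurable spaces $\mathcal{X}$ and $\mathcal{A}$ (with $\sigma$-fields containing all singletons) and a jointly measurable loss function $L:\mathcal{X}\times\mathcal{A}\to(-\infty,\infty]$. $\mathcal{P}_0$ is the set of all probability distributions on $\mathcal{X}$. Expectations are taken in the extended sense $E f=E f^+-E f^-$, defined unless both terms are infinite. $L(P,a):=E_P\{L(X,a)\}$, and $\mathcal{P}$ is the set of all $P\in\mathcal{P}_0$ such that $L(P,a)$ is defined for all $a\in\mathcal{A}$. For a randomized act $\zeta$ (a probability distribution on $\mathcal{A}$), $L(x,\zeta):=E_{A\sim\zeta}\{L(x,A)\}$ and $L(P,\zeta):=E_{(X,A)\sim P\times\zeta}\{L(X,A)\}$; $\mathcal{Z}$ is the set of all $\zeta$ such that $L(P,\zeta)$ is defined for all $P\in\mathcal{P}$. An act $\zeta_P\in\mathcal{Z}$ is Bayes against $P$ (a Bayes act of $P$) if $E_P\{L(X,\zeta)-L(X,\zeta_P)\}\in[0,\infty]$ for all $\zeta\in\mathcal{Z}$. The generalized entropy is $H(P):=\inf_{a\in\mathcal{A}}L(P,a)$. The discrepancy is $D(P,\zeta):=L(P,\zeta)-H(P)$ when $H(P)$ is finite; if $H(P)$ is not finite or $P\notin\mathcal P$, but $P$ has a Bayes act $\zeta_P$, then $D(P,\zeta):=E_P\{L(X,\zeta)-L(X,\zeta_P)\}$. Write $\Theta_0$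 for $\mathcal{P}_0$ regarded as a parameter space, with the weak topology and its Borel $\sigma$-field; $\theta\in\Theta_0$ regarded as a distribution on $\mathcal{X}$ is written $P_\theta$. $\Theta:=\{\theta\in\Theta_0:D(P_\theta,a)\text{ is defined for all }a\in\mathcal{A}\}$. A law is a probability distribution $\Pi$ on $\Theta_0$; its mean $P_\Pi\in\mathcal{P}_0$ is $P_\Pi(B)=E_{\Theta\sim\Pi}\{P_\Theta(B)\}$ for Borel $B\subseteq\mathcal{X}$. For $\Omega\subseteq\Theta$, $\Delta$ is the set of laws giving all their mass to $\Omega$. Tightness of $\Omega$ means: for all $\varepsilon>0$ there is a compact $C\subseteq\mathcal{X}$ with $P_\omega(C)>1-\varepsilon$ for all $\omega\in\Omega$. The derived game has loss $\widehat{L}(\theta,\zeta):=D(P_\theta,\zeta)$ for $\theta\in\Theta$, $\zeta\in\mathcal{Z}$, with $\widehat{L}(\Pi,\zeta):=E_{\Theta\sim\Pi}\{\widehat{L}(\Theta,\zeta)\}$ and derived entropy $\widehat{H}(\Pi):=\inf_{a\in\mathcal{A}}\widehat{L}(\Pi,a)$. In the restricted derived game $\widehat{\mathcal{G}}^\Omega$ Nature chooses $\Pi\in\Delta$, the Decision Maker chooses $\zeta\in\mathcal{Z}$, and the loss is $\widehat{L}(\Pi,\zeta)$; it has value $V$ if $V=\sup_{\Pi\in\Delta}\inf_{\zeta\in\mathcal{Z}}\widehat{L}(\Pi,\zeta)=\inf_{\zeta\in\mathcal{Z}}\sup_{\Pi\in\Delta}\widehat{L}(\Pi,\zeta)$ is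 finite, and a minimax (robust Bayes) act is one attaining $\inf_{\zeta\in\mathcal{Z}}\sup_{\Pi\in\Delta}\widehat{L}(\Pi,\zeta)$.
   Formalization: In condition (1) the Bayes act ζ_0 is taken to depend only on the limit Q_0, the same for all sequences (Q_n) converging to Q_0; if ζ_0 may vary with the sequence, the claim fails under the continuum hypothesis. *)

theory Defs
  imports "HOL-Probability.Probability"
begin

text \<open>
  Expectation in the extended sense, \<open>E f = E f\<^sup>+ - E f\<^sup>-\<close>. The value is only meaningful if
  \<open>ext_defined\<close> holds; otherwise the subtraction has the arbitrary value \<open>\<infinity> - \<infinity> = \<infinity>\<close> of type
  \<^typ>\<open>ereal\<close>. For a function that is not measurable, \<^const>\<open>nn_integral\<close> is the lower integral.
\<close>

definition ext_defined :: "'b measure \<Rightarrow> ('b \<Rightarrow> ereal) \<Rightarrow> bool" where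
  "ext_defined M f \<longleftrightarrow>
     \<not> ((\<integral>\<^sup>+ x. e2ennreal (f x) \<partial>M) = \<infinity> \<and> (\<integral>\<^sup>+ x. e2ennreal (- f x) \<partial>M) = \<infinity>)"

definition ext_expect :: "'b measure \<Rightarrow> ('b \<Rightarrow> ereal) \<Rightarrow> ereal" where
  "ext_expect M f =
     enn2ereal (\<integral>\<^sup>+ x. e2ennreal (f x) \<partial>M) - enn2ereal (\<integral>\<^sup>+ x. e2ennreal (- f x) \<partial>M)"

abbreviation distributions :: "'b measure \<Rightarrow> 'b measure set" where
  "distributions M \<equiv> space (prob_algebra M)"


section \<open>Basic games\<close>

definition basic_game :: "'x measure \<Rightarrow> 'a measure \<Rightarrow> ('x \<Rightarrow> 'a \<Rightarrow> ereal) \<Rightarrow> bool" where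
  "basic_game M A L \<longleftrightarrow>
     (\<forall>x\<in>space M. {x} \<in> sets M) \<and>
     (\<forall>a\<in>space A. {a} \<in> sets A) \<and>
     (\<lambda>(x, a). L x a) \<in> borel_measurable (M \<Otimes>\<^sub>M A) \<and>
     (\<forall>x\<in>space M. \<forall>a\<in>space A. L x a \<noteq> - \<infinity>)"

text \<open>\<open>loss_dists\<close> is the paper's \<open>\<P>\<close>, \<open>rand_acts\<close> its \<open>\<Z>\<close>; \<open>loss_pt\<close>, \<open>loss_act\<close> and \<open>loss\<close> are
  \<open>L(x,\<zeta>)\<close>, \<open>L(P,a)\<close> and \<open>L(P,\<zeta>)\<close>.\<close>

definition loss_act :: "('x \<Rightarrow> 'a \<Rightarrow> ereal) \<Rightarrow> 'x measure \<Rightarrow> 'a \<Rightarrow> ereal" where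
  "loss_act L P a = ext_expect P (\<lambda>x. L x a)"

definition loss_dists :: "'x measure \<Rightarrow> 'a measure \<Rightarrow> ('x \<Rightarrow> 'a \<Rightarrow> ereal) \<Rightarrow> 'x measure set" where
  "loss_dists M A L = {P \<in> distributions M. \<forall>a\<in>space A. ext_defined P (\<lambda>x. L x a)}"

definition loss_pt :: "('x \<Rightarrow> 'a \<Rightarrow> ereal) \<Rightarrow> 'x \<Rightarrow> 'a measure \<Rightarrow> ereal" where
  "loss_pt L x \<zeta> = ext_expect \<zeta> (L x)"

definition loss_defined :: "('x \<Rightarrow> 'a \<Rightarrow> ereal) \<Rightarrow> 'x measure \<Rightarrow> 'a measure \<Rightarrow> bool" where
  "loss_defined L P \<zeta> \<longleftrightarrow> ext_defined (P \<Otimes>\<^sub>M \<zeta>) (\<lambda>(x, a). L x a)"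

definition loss :: "('x \<Rightarrow> 'a \<Rightarrow> ereal) \<Rightarrow> 'x measure \<Rightarrow> 'a measure \<Rightarrow> ereal" where
  "loss L P \<zeta> = ext_expect (P \<Otimes>\<^sub>M \<zeta>) (\<lambda>(x, a). L x a)"

definition rand_acts :: "'x measure \<Rightarrow> 'a measure \<Rightarrow> ('x \<Rightarrow> 'a \<Rightarrow> ereal) \<Rightarrow> 'a measure set" where
  "rand_acts M A L = {\<zeta> \<in> distributions A. \<forall>P\<in>loss_dists M A L. loss_defined L P \<zeta>}"

text \<open>
  \<open>E\<^sub>P {L(X,\<zeta>) - L(X,\<zeta>')}\<close> and its definedness. The first conjunct of \<open>regret_defined\<close> requires that,
  almost surely, the difference is not of the form \<open>\<infinity> - \<infinity>\<close> or \<open>(-\<infinity>) - (-\<infinity>)\<close>, which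
  \<^typ>\<open>ereal\<close> subtraction would evaluate to \<open>\<infinity>\<close>.
\<close>

definition regret_defined :: "('x \<Rightarrow> 'a \<Rightarrow> ereal) \<Rightarrow> 'x measure \<Rightarrow> 'a measure \<Rightarrow> 'a measure \<Rightarrow> bool" where
  "regret_defined L P \<zeta> \<zeta>' \<longleftrightarrow>
     (AE x in P. \<not> (\<bar>loss_pt L x \<zeta>\<bar> = \<infinity> \<and> loss_pt L x \<zeta> = loss_pt L x \<zeta>')) \<and>
     ext_defined P (\<lambda>x. loss_pt L x \<zeta> - loss_pt L x \<zeta>')"

definition regret :: "('x \<Rightarrow> 'a \<Rightarrow> ereal) \<Rightarrow> 'x measure \<Rightarrow> 'a measure \<Rightarrow> 'a measure \<Rightarrow> ereal" where
  "regret L P \<zeta> \<zeta>' = ext_expect P (\<lambda>x. loss_pt L x \<zeta> - loss_pt L x \<zeta>')"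

definition bayes_act ::
  "'x measure \<Rightarrow> 'a measure \<Rightarrow> ('x \<Rightarrow> 'a \<Rightarrow> ereal) \<Rightarrow> 'x measure \<Rightarrow> 'a measure \<Rightarrow> bool" where
  "bayes_act M A L P \<zeta>\<^sub>P \<longleftrightarrow>
     \<zeta>\<^sub>P \<in> rand_acts M A L \<and>
     (\<forall>\<zeta>\<in>rand_acts M A L. regret_defined L P \<zeta> \<zeta>\<^sub>P \<and> 0 \<le> regret L P \<zeta> \<zeta>\<^sub>P)"

definition gen_entropy :: "'a measure \<Rightarrow> ('x \<Rightarrow> 'a \<Rightarrow> ereal) \<Rightarrow> 'x measure \<Rightarrow> ereal" where
  "gen_entropy A L P = (INF a\<in>space A. loss_act L P a)"

definition finite_entropy :: "'x measure \<Rightarrow> 'a measure \<Rightarrow> ('x \<Rightarrow> 'a \<Rightarrow> ereal) \<Rightarrow> 'x measure \<Rightarrow> bool" where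
  "finite_entropy M A L P \<longleftrightarrow> P \<in> loss_dists M A L \<and> \<bar>gen_entropy A L P\<bar> \<noteq> \<infinity>"

text \<open>If \<open>H(P)\<close> is not finite, the discrepancy is taken relative to an arbitrary Bayes act of \<open>P\<close>;
  its value does not depend on which one.\<close>

definition some_bayes_act ::
  "'x measure \<Rightarrow> 'a measure \<Rightarrow> ('x \<Rightarrow> 'a \<Rightarrow> ereal) \<Rightarrow> 'x measure \<Rightarrow> 'a measure" where
  "some_bayes_act M A L P = (SOME \<zeta>\<^sub>P. bayes_act M A L P \<zeta>\<^sub>P)"

definition discrepancy_defined ::
  "'x measure \<Rightarrow> 'a measure \<Rightarrow> ('x \<Rightarrow> 'a \<Rightarrow> ereal) \<Rightarrow> 'x measure \<Rightarrow> 'a measure \<Rightarrow> bool" where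
  "discrepancy_defined M A L P \<zeta> \<longleftrightarrow>
     (if finite_entropy M A L P then loss_defined L P \<zeta>
      else (\<exists>\<zeta>\<^sub>P. bayes_act M A L P \<zeta>\<^sub>P) \<and> regret_defined L P \<zeta> (some_bayes_act M A L P))"

definition discrepancy ::
  "'x measure \<Rightarrow> 'a measure \<Rightarrow> ('x \<Rightarrow> 'a \<Rightarrow> ereal) \<Rightarrow> 'x measure \<Rightarrow> 'a measure \<Rightarrow> ereal" where
  "discrepancy M A L P \<zeta> =
     (if finite_entropy M A L P then loss L P \<zeta> - gen_entropy A L P
      else regret L P \<zeta> (some_bayes_act M A L P))"


section \<open>The weak topology, laws and their means\<close>

definition weak_topology :: "'x::topological_space measure topology" where
  "weak_topology = topology_generated_by
     {{P \<in> distributions borel. (\<integral>x. f x \<partial>P) \<in> U} | (f :: 'x \<Rightarrow> real) U.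
        continuous_on UNIV f \<and> bounded (range f) \<and> open U}"

definition weak_borel :: "'x::topological_space measure measure" where
  "weak_borel = sigma (distributions borel) {U. openin weak_topology U}"

text \<open>Parameters \<open>\<theta>\<close> are distributions, so \<open>P\<^sub>\<theta>\<close> is \<open>\<theta>\<close> itself. A pure act \<open>a\<close>, regarded as an
  element of \<open>\<Z>\<close>, is the point mass \<open>return A a\<close>.\<close>

definition param_space :: "'a measure \<Rightarrow> ('x::topological_space \<Rightarrow> 'a \<Rightarrow> ereal) \<Rightarrow> 'x measure set" where
  "param_space A L =
     {\<theta> \<in> distributions borel. \<forall>a\<in>space A. discrepancy_defined borel A L \<theta> (return A a)}"

text \<open>A law \<open>\<Pi>\<close> of the paper is written \<open>\<mu>\<close>, since \<open>\<Pi>\<close> is the syntax for dependent products.\<close>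

definition mean_dist :: "'x::topological_space measure measure \<Rightarrow> 'x measure" where
  "mean_dist \<mu> = measure_of UNIV (sets borel) (\<lambda>B. \<integral>\<^sup>+ \<theta>. emeasure \<theta> B \<partial>\<mu>)"

definition priors :: "'x::topological_space measure set \<Rightarrow> 'x measure measure set" where
  "priors \<Omega> = {\<mu> \<in> distributions weak_borel. AE \<theta> in \<mu>. \<theta> \<in> \<Omega>}"

definition mixtures :: "'x::topological_space measure set \<Rightarrow> 'x measure set" where
  "mixtures \<Omega> = mean_dist ` priors \<Omega>"

definition convex_dists :: "'x measure set \<Rightarrow> bool" where
  "convex_dists \<Gamma> \<longleftrightarrow>
     (\<forall>P\<in>\<Gamma>. \<forall>Q\<in>\<Gamma>. \<forall>t\<in>{0..1::real}. \<exists>R\<in>\<Gamma>.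
        \<forall>B\<in>sets R. measure R B = t * measure P B + (1 - t) * measure Q B)"

definition tight_model :: "'x::topological_space measure set \<Rightarrow> bool" where
  "tight_model \<Omega> \<longleftrightarrow> (\<forall>\<epsilon>>0. \<exists>C. compact C \<and> (\<forall>P\<in>\<Omega>. measure P C > 1 - \<epsilon>))"

definition admissible_seq ::
  "'a measure \<Rightarrow> ('x::topological_space \<Rightarrow> 'a \<Rightarrow> ereal) \<Rightarrow> 'x measure set \<Rightarrow>
     (nat \<Rightarrow> 'x measure) \<Rightarrow> 'x measure \<Rightarrow> bool" where
  "admissible_seq A L \<Gamma> Q Q\<^sub>0 \<longleftrightarrow>
     (\<forall>n. Q n \<in> \<Gamma>) \<and>
     (\<forall>n. \<exists>\<zeta>. bayes_act borel A L (Q n) \<zeta>) \<and>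
     (\<exists>b::real. \<forall>n. ereal b \<le> gen_entropy A L (Q n)) \<and>
     limitin weak_topology Q Q\<^sub>0 sequentially"

text \<open>
  The Bayes act \<open>\<zeta>\<^sub>0\<close> is a choice made for the limit \<open>Q\<^sub>0\<close>, the same for all admissible sequences
  that converge to \<open>Q\<^sub>0\<close>, whereas the Bayes acts \<open>\<zeta> n\<close> of the \<open>Q n\<close> may depend on the sequence.
  The existence of a minimax act is not guaranteed if \<open>\<zeta>\<^sub>0\<close> may vary with the sequence: let
  \<open>X = [0,1]\<close>, let \<open>\<Omega>\<close> be the point masses, let the acts be the meagre \<open>F\<^sub>\<sigma>\<close> sets \<open>S\<close> (with the full
  power set as \<open>\<sigma>\<close>-field), and let \<open>L(x,S)\<close> be \<open>0\<close> or \<open>1\<close> according to whether \<open>x \<in> S\<close>. Countably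
  many distributions have a common Bayes act of loss \<open>0\<close>, so the derived game has lower value
  \<open>0\<close>; but under the continuum hypothesis randomized acts are discrete, and the upper value is \<open>1\<close>.
\<close>

definition bayes_lsc ::
  "'a measure \<Rightarrow> ('x::topological_space \<Rightarrow> 'a \<Rightarrow> ereal) \<Rightarrow> 'x measure set \<Rightarrow> bool" where
  "bayes_lsc A L \<Gamma> \<longleftrightarrow>
     (\<forall>Q\<^sub>0\<in>distributions borel. (\<exists>Q. admissible_seq A L \<Gamma> Q Q\<^sub>0) \<longrightarrow>
        Q\<^sub>0 \<in> loss_dists borel A L \<and>
        (\<exists>\<zeta>\<^sub>0. bayes_act borel A L Q\<^sub>0 \<zeta>\<^sub>0 \<and>
           (\<forall>Q. admissible_seq A L \<Gamma> Q Q\<^sub>0 \<longrightarrow>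
              (\<exists>\<zeta>. (\<forall>n. bayes_act borel A L (Q n) (\<zeta> n)) \<and>
                   (\<forall>P\<in>\<Gamma>. loss L P \<zeta>\<^sub>0 \<le> liminf (\<lambda>n. loss L P (\<zeta> n)))))))"


section \<open>The derived game\<close>

definition derived_loss ::
  "'a measure \<Rightarrow> ('x::topological_space \<Rightarrow> 'a \<Rightarrow> ereal) \<Rightarrow> 'x measure \<Rightarrow> 'a measure \<Rightarrow> ereal" where
  "derived_loss A L \<theta> \<zeta> = discrepancy borel A L \<theta> \<zeta>"

text \<open>
  \<open>\<theta> \<mapsto> H(P\<^sub>\<theta>)\<close> is an infimum over a possibly uncountable set of acts. Where it fails to be
  measurable, \<open>ext_expect\<close> below is a difference of lower integrals.
\<close>

definition derived_loss_law ::
  "'a measure \<Rightarrow> ('x::topological_space \<Rightarrow> 'a \<Rightarrow> ereal) \<Rightarrow> 'x measure measure \<Rightarrow> 'a measure \<Rightarrow> ereal" where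
  "derived_loss_law A L \<mu> \<zeta> = ext_expect \<mu> (\<lambda>\<theta>. derived_loss A L \<theta> \<zeta>)"

definition derived_entropy ::
  "'a measure \<Rightarrow> ('x::topological_space \<Rightarrow> 'a \<Rightarrow> ereal) \<Rightarrow> 'x measure measure \<Rightarrow> ereal" where
  "derived_entropy A L \<mu> = (INF a\<in>space A. derived_loss_law A L \<mu> (return A a))"

definition max_derived_entropy ::
  "'a measure \<Rightarrow> ('x::topological_space \<Rightarrow> 'a \<Rightarrow> ereal) \<Rightarrow> 'x measure set \<Rightarrow> ereal" where
  "max_derived_entropy A L \<Omega> = (SUP \<mu>\<in>priors \<Omega>. derived_entropy A L \<mu>)"

definition game_has_value :: "'p set \<Rightarrow> 'z set \<Rightarrow> ('p \<Rightarrow> 'z \<Rightarrow> ereal) \<Rightarrow> ereal \<Rightarrow> bool" where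
  "game_has_value D Z f V \<longleftrightarrow>
     V = (SUP p\<in>D. INF z\<in>Z. f p z) \<and> V = (INF z\<in>Z. SUP p\<in>D. f p z) \<and> \<bar>V\<bar> \<noteq> \<infinity>"

definition minimax_act :: "'p set \<Rightarrow> 'z set \<Rightarrow> ('p \<Rightarrow> 'z \<Rightarrow> ereal) \<Rightarrow> 'z \<Rightarrow> bool" where
  "minimax_act D Z f z \<longleftrightarrow> z \<in> Z \<and> (SUP p\<in>D. f p z) = (INF z'\<in>Z. SUP p\<in>D. f p z')"

end

theory Submission
  imports Defs
begin

text \<open>
  Averaging over a prior \<open>\<mu>\<close> turns the derived loss into \<open>L(P\<^sub>\<mu>, \<zeta>) - c(\<mu>)\<close>, where \<open>c(\<mu>)\<close> does not
  depend on the act; hence Bayes acts of the mean are optimal against \<open>\<mu>\<close> in the derived game. Take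
  priors \<open>\<mu>\<^sub>n\<close> whose derived entropies converge to the supremum \<open>V\<close>. By tightness their means have a
  weakly convergent subsequence, with limit \<open>Q\<^sub>0\<close>, and adding a vanishing proportion of an arbitrary prior
  \<open>\<nu>\<close> does not change the limit. The derived entropy of these perturbations is at most \<open>V\<close>, which bounds
  the loss of their Bayes acts against \<open>\<nu>\<close> by \<open>V + o(1)\<close>. By lower semicontinuity the Bayes act
  \<open>\<zeta>\<^sub>0\<close> of \<open>Q\<^sub>0\<close> has loss at most \<open>V\<close> against every prior.
\<close>

section \<open>Lower integrals and extended expectations\<close>

text \<open>Near-optimality of a prior bounds the loss of its Bayes act against that prior only and
  says nothing about another prior \<open>\<nu>\<close>. Hence the perturbation: a Bayes act of a
  mixture is tested against \<open>\<nu>\<close> as well, with a weight that vanishes more slowly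
  than the optimality gap. Only the means of the priors are sent to a limit, not the priors, and
  \<open>Q\<^sub>0\<close> need not be a mixture itself; it merely supplies one act, which
  \<open>bayes_lsc\<close> attaches to the limit and not to the sequence, so that it is chosen
  before \<open>\<nu>\<close>. The obstacle is measurability: the entropy of \<open>\<theta>\<close>
  may be a nonmeasurable function of \<open>\<theta>\<close>, so averages over laws are lower
  integrals. Two facts still hold for these: additivity when one summand is measurable, which
  isolates the constant \<open>c\<close>, and, for nonnegative integrands, the inequality that a
  mixture of laws has at least the mixed integral, which is the direction that the perturbation
  uses.\<close>

lemma nn_integral_minorant:
  obtains g where "g \<in> borel_measurable M" "g \<le> f" "integral\<^sup>N M g = integral\<^sup>N M f"
proof -
  let ?S = "{g. simple_function M g \<and> g \<le> f}"
  have "integral\<^sup>S M ` ?S \<noteq> {}"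
    by (auto intro!: exI[of _ "\<lambda>_. 0"] simp: le_fun_def)
  from ennreal_Sup_countable_SUP[OF this] obtain F :: "nat \<Rightarrow> ennreal"
    where F: "range F \<subseteq> integral\<^sup>S M ` ?S" "Sup (integral\<^sup>S M ` ?S) = (SUP i. F i)"
    by blast
  then have "\<forall>i. \<exists>g. simple_function M g \<and> g \<le> f \<and> F i = integral\<^sup>S M g"
    by (fastforce simp: image_iff subset_iff)
  then obtain G where G: "\<And>i. simple_function M (G i)" "\<And>i. G i \<le> f" "\<And>i. F i = integral\<^sup>S M (G i)"
    by metis
  \<comment> \<open>Countably many simple minorants already exhaust the lower integral, so their
    supremum is a measurable minorant with the same integral.\<close>
  define g where "g = (\<lambda>x. SUP i. G i x)"
  have g: "g \<in> borel_measurable M"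
    unfolding g_def by (rule borel_measurable_SUP) (auto intro: borel_measurable_simple_function G(1))
  have le: "g \<le> f"
    using G(2) by (auto simp: g_def le_fun_def intro!: SUP_least)
  have "integral\<^sup>N M f = (SUP i. F i)"
    using F(2) by (simp add: nn_integral_def)
  also have "\<dots> \<le> integral\<^sup>N M g"
    unfolding G(3) nn_integral_eq_simple_integral[OF G(1), symmetric]
    by (intro SUP_least nn_integral_mono) (auto simp: g_def intro: SUP_upper)
  finally have "integral\<^sup>N M g = integral\<^sup>N M f"
    using nn_integral_mono[of M g f] le by (auto simp: le_fun_def intro: antisym)
  with g le show thesis by (rule that)
qed

text \<open>Subtraction in \<open>ennreal\<close> is truncated at 0, so both sides are the maximum
  of \<open>f\<close> and \<open>g\<close>, also at infinite values.\<close>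

lemma ennreal_add_diff_commute: "f + (g - f) = g + (f - g)" for f g :: ennreal
  by (cases f; cases g) (auto simp: ennreal_minus ennreal_plus_if)

text \<open>For a function that is not measurable, \<^const>\<open>nn_integral\<close> is the lower integral, which is
  only superadditive in general.\<close>

lemma nn_integral_add_lower:
  assumes [measurable]: "f \<in> borel_measurable M"
  shows "(\<integral>\<^sup>+x. f x + h x \<partial>M) = integral\<^sup>N M f + integral\<^sup>N M h"
proof (rule antisym)
  show "(\<integral>\<^sup>+x. f x + h x \<partial>M) \<le> integral\<^sup>N M f + integral\<^sup>N M h"
  proof (cases "integral\<^sup>N M f = \<infinity>")
    case False
    \<comment> \<open>Where \<open>f\<close> is finite, a measurable minorant \<open>g\<close> of
      the sum satisfies \<open>g - f \<le> h\<close>. Adding \<open>f\<close> back gives the maximum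
      of \<open>f\<close> and \<open>g\<close>, which is enough for an upper bound.\<close>
    obtain g where g[measurable]: "g \<in> borel_measurable M" and le: "g \<le> (\<lambda>x. f x + h x)"
      and eq: "integral\<^sup>N M g = (\<integral>\<^sup>+x. f x + h x \<partial>M)"
      by (rule nn_integral_minorant)
    have "integral\<^sup>N M g \<le> (\<integral>\<^sup>+x. f x + (g x - f x) \<partial>M)"
      by (intro nn_integral_mono) (subst ennreal_add_diff_commute, simp)
    also have "\<dots> = integral\<^sup>N M f + (\<integral>\<^sup>+x. g x - f x \<partial>M)"
      by (intro nn_integral_add) auto
    also have "(\<integral>\<^sup>+x. g x - f x \<partial>M) \<le> integral\<^sup>N M h"
    proof (rule nn_integral_mono_AE)
      have "AE x in M. f x \<noteq> \<infinity>"
        using False by (intro nn_integral_PInf_AE) auto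
      then show "AE x in M. g x - f x \<le> h x"
        by eventually_elim (use le in \<open>auto simp: ennreal_minus_le_iff le_fun_def\<close>)
    qed
    finally show ?thesis
      using eq by (simp add: add_left_mono)
  qed simp
  obtain h' where h'[measurable]: "h' \<in> borel_measurable M" and le: "h' \<le> h"
    and eq: "integral\<^sup>N M h' = integral\<^sup>N M h"
    by (rule nn_integral_minorant)
  have "integral\<^sup>N M f + integral\<^sup>N M h = (\<integral>\<^sup>+x. f x + h' x \<partial>M)"
    using eq by (simp add: nn_integral_add)
  also have "\<dots> \<le> (\<integral>\<^sup>+x. f x + h x \<partial>M)"
    using le by (intro nn_integral_mono add_left_mono) (auto simp: le_fun_def)
  finally show "integral\<^sup>N M f + integral\<^sup>N M h \<le> (\<integral>\<^sup>+x. f x + h x \<partial>M)" .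
qed

lemma ext_expect_mono:
  assumes "\<And>x. x \<in> space M \<Longrightarrow> f x \<le> g x"
  shows "ext_expect M f \<le> ext_expect M g"
  unfolding ext_expect_def
  by (intro ereal_minus_mono) (auto simp: less_eq_ennreal.rep_eq[symmetric] assms
      intro!: nn_integral_mono e2ennreal_mono)

lemma ext_expect_nonneg:
  assumes "AE x in M. 0 \<le> f x"
  shows "ext_expect M f = enn2ereal (\<integral>\<^sup>+x. e2ennreal (f x) \<partial>M)"
proof -
  have "(\<integral>\<^sup>+x. e2ennreal (- f x) \<partial>M) = (\<integral>\<^sup>+x. 0 \<partial>M)"
    using assms by (intro nn_integral_cong_AE) (auto elim!: eventually_mono simp: e2ennreal_neg)
  then show ?thesis
    by (simp add: ext_expect_def zero_ennreal.rep_eq)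
qed

text \<open>Meant for the truncated differences \<open>a = f - g\<close> and
  \<open>b = g - f\<close>. The bounds \<open>a \<le> f\<close> and \<open>b \<le> g\<close> exclude
  infinite \<open>a\<close> and \<open>b\<close> over finite \<open>f\<close> and \<open>g\<close>,
  which the equation alone would permit.\<close>

lemma ereal_diff_eq_diff_ennreal:
  fixes a b f g :: ennreal
  assumes "f + b = g + a" "a \<le> f" "b \<le> g" "f \<noteq> \<infinity> \<or> g \<noteq> \<infinity>"
  shows "enn2ereal a - enn2ereal b = enn2ereal f - enn2ereal g"
  using assms by (cases a; cases b; cases f; cases g) (auto simp: top_unique simp flip: ennreal_plus)

lemma ext_expect_diff:
  assumes [measurable]: "f \<in> borel_measurable M" "g \<in> borel_measurable M"
    and fin: "integral\<^sup>N M f \<noteq> \<infinity> \<or> integral\<^sup>N M g \<noteq> \<infinity>"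
    and u: "AE x in M. u x = enn2ereal (f x) - enn2ereal (g x)"
  shows "ext_expect M u = enn2ereal (integral\<^sup>N M f) - enn2ereal (integral\<^sup>N M g)"
proof -
  \<comment> \<open>Where both are infinite, \<open>\<infinity> - \<infinity> = \<infinity>\<close>,
    and negating \<open>u\<close> would not exchange \<open>f\<close> and \<open>g\<close>. One
    finite integral makes such points negligible.\<close>
  have "(AE x in M. f x \<noteq> \<infinity>) \<or> (AE x in M. g x \<noteq> \<infinity>)"
    using fin nn_integral_PInf_AE[of f M] nn_integral_PInf_AE[of g M] by auto
  then have ae: "AE x in M. f x \<noteq> \<infinity> \<or> g x \<noteq> \<infinity>"
    by (auto elim: eventually_mono)
  let ?a = "\<integral>\<^sup>+x. f x - g x \<partial>M" and ?b = "\<integral>\<^sup>+x. g x - f x \<partial>M"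
  have a: "(\<integral>\<^sup>+x. e2ennreal (u x) \<partial>M) = ?a"
    using u by (intro nn_integral_cong_AE) auto
  have b: "(\<integral>\<^sup>+x. e2ennreal (- u x) \<partial>M) = ?b"
  proof (intro nn_integral_cong_AE)
    show "AE x in M. e2ennreal (- u x) = g x - f x"
      using u ae
    proof eventually_elim
      case (elim x)
      then have "- u x = enn2ereal (g x) - enn2ereal (f x)"
        by (cases "f x"; cases "g x") auto
      then show ?case by simp
    qed
  qed
  have "integral\<^sup>N M f + ?b = integral\<^sup>N M g + ?a"
    by (simp add: ennreal_add_diff_commute flip: nn_integral_add)
  moreover have "?a \<le> integral\<^sup>N M f" "?b \<le> integral\<^sup>N M g"
    by (auto intro!: nn_integral_mono ennreal_diff_le_mono_left)
  ultimately show ?thesis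
    unfolding ext_expect_def a b using fin by (intro ereal_diff_eq_diff_ennreal) auto
qed

lemma ennreal_diff_add_eq:
  fixes u u' p n :: ennreal
  assumes "u \<noteq> \<infinity>" "u' \<noteq> \<infinity>" "p \<noteq> \<infinity> \<or> n \<noteq> \<infinity>"
  shows "(enn2ereal u - enn2ereal u') - (enn2ereal p - enn2ereal n)
    = enn2ereal (u + n) - enn2ereal (u' + p)"
  using assms unfolding plus_ennreal.rep_eq by (cases u; cases u'; cases p; cases n) auto

lemma ennreal_diff_le_diff:
  fixes u u' p n :: ennreal
  assumes "u \<noteq> \<infinity>" "u' \<noteq> \<infinity>" "p \<noteq> \<infinity> \<or> n \<noteq> \<infinity>" "0 \<le> enn2ereal (u + n) - enn2ereal (u' + p)"
  shows "enn2ereal p - enn2ereal n \<le> enn2ereal u - enn2ereal u'"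
  using assms unfolding plus_ennreal.rep_eq by (cases u; cases u'; cases p; cases n) auto

lemma ereal_parts: "enn2ereal (e2ennreal x) - enn2ereal (e2ennreal (- x)) = x"
  by (cases x) (auto simp: ennreal.rep_eq e2ennreal_neg max_def zero_ennreal.rep_eq)


section \<open>Loss and entropy in the basic game\<close>

text \<open>Integrating over \<open>P\<close> last makes passage to the mean of a law a further
  integration in front.\<close>

definition pos_loss :: "('x \<Rightarrow> 'a \<Rightarrow> ereal) \<Rightarrow> 'x measure \<Rightarrow> 'a measure \<Rightarrow> ennreal" where
  "pos_loss L P \<zeta> = (\<integral>\<^sup>+x. \<integral>\<^sup>+a. e2ennreal (L x a) \<partial>\<zeta> \<partial>P)"

abbreviation neg_loss :: "('x \<Rightarrow> 'a \<Rightarrow> ereal) \<Rightarrow> 'x measure \<Rightarrow> 'a measure \<Rightarrow> ennreal" where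
  "neg_loss L \<equiv> pos_loss (\<lambda>x a. - L x a)"

locale game =
  fixes M :: "'x measure" and A :: "'a measure" and L :: "'x \<Rightarrow> 'a \<Rightarrow> ereal"
  assumes game: "basic_game M A L"
begin

lemma L_measurable[measurable]: "(\<lambda>(x, a). L x a) \<in> borel_measurable (M \<Otimes>\<^sub>M A)"
  using game by (simp add: basic_game_def)

lemma L_PairD[measurable]:
  assumes "sets P = sets M" "sets \<zeta> = sets A"
  shows "(\<lambda>(x, a). L x a) \<in> borel_measurable (P \<Otimes>\<^sub>M \<zeta>)"
  using L_measurable assms by (simp cong: measurable_cong_sets sets_pair_measure_cong)

lemma distD: "P \<in> distributions N \<Longrightarrow> sets P = sets N \<and> prob_space P"
  by (simp add: space_prob_algebra)

lemma inner_measurable: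
  assumes "sets P = sets M" "\<zeta> \<in> distributions A"
  shows "(\<lambda>x. \<integral>\<^sup>+a. e2ennreal (L x a) \<partial>\<zeta>) \<in> borel_measurable P"
    "(\<lambda>x. \<integral>\<^sup>+a. e2ennreal (- L x a) \<partial>\<zeta>) \<in> borel_measurable P"
proof -
  interpret \<zeta>: prob_space \<zeta> using assms distD by blast
  note [measurable] = L_PairD[OF assms(1), of \<zeta>]
  have [simp]: "sets \<zeta> = sets A" using assms distD by blast
  show "(\<lambda>x. \<integral>\<^sup>+a. e2ennreal (L x a) \<partial>\<zeta>) \<in> borel_measurable P"
    "(\<lambda>x. \<integral>\<^sup>+a. e2ennreal (- L x a) \<partial>\<zeta>) \<in> borel_measurable P"
    by measurable
qed

lemma loss_parts:
  assumes "P \<in> distributions M" "\<zeta> \<in> distributions A"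
  shows "loss L P \<zeta> = enn2ereal (pos_loss L P \<zeta>) - enn2ereal (neg_loss L P \<zeta>)"
    and "loss_defined L P \<zeta> \<longleftrightarrow> \<not> (pos_loss L P \<zeta> = \<infinity> \<and> neg_loss L P \<zeta> = \<infinity>)"
proof -
  interpret \<zeta>: prob_space \<zeta> using assms distD by blast
  have [simp]: "sets \<zeta> = sets A" "sets P = sets M" using assms distD by blast+
  note [measurable] = L_PairD[of P \<zeta>]
  have "(\<integral>\<^sup>+z. e2ennreal (case z of (x, a) \<Rightarrow> L x a) \<partial>(P \<Otimes>\<^sub>M \<zeta>)) = pos_loss L P \<zeta>"
    "(\<integral>\<^sup>+z. e2ennreal (- (case z of (x, a) \<Rightarrow> L x a)) \<partial>(P \<Otimes>\<^sub>M \<zeta>)) = neg_loss L P \<zeta>"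
    unfolding pos_loss_def by (subst \<zeta>.nn_integral_fst[symmetric]; simp)+
  then show "loss L P \<zeta> = enn2ereal (pos_loss L P \<zeta>) - enn2ereal (neg_loss L P \<zeta>)"
    "loss_defined L P \<zeta> \<longleftrightarrow> \<not> (pos_loss L P \<zeta> = \<infinity> \<and> neg_loss L P \<zeta> = \<infinity>)"
    by (simp_all add: loss_def loss_defined_def ext_expect_def ext_defined_def)
qed

lemma L_section:
  assumes "x \<in> space M" shows "L x \<in> borel_measurable A"
  using measurable_compose[OF measurable_Pair1'[OF assms] L_measurable] by simp

lemma pos_loss_return:
  assumes "P \<in> distributions M" "a \<in> space A"
  shows "pos_loss L P (return A a) = (\<integral>\<^sup>+x. e2ennreal (L x a) \<partial>P)"
    and "neg_loss L P (return A a) = (\<integral>\<^sup>+x. e2ennreal (- L x a) \<partial>P)"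
proof -
  have sp: "space P = space M" using assms distD sets_eq_imp_space_eq by blast
  have *: "(\<integral>\<^sup>+b. e2ennreal (L x b) \<partial>return A a) = e2ennreal (L x a)"
    "(\<integral>\<^sup>+b. e2ennreal (- L x b) \<partial>return A a) = e2ennreal (- L x a)" if "x \<in> space P" for x
    using L_section[of x, measurable] that sp assms(2) by (simp_all add: nn_integral_return)
  show "pos_loss L P (return A a) = (\<integral>\<^sup>+x. e2ennreal (L x a) \<partial>P)"
    "neg_loss L P (return A a) = (\<integral>\<^sup>+x. e2ennreal (- L x a) \<partial>P)"
    unfolding pos_loss_def by (simp_all add: * cong: nn_integral_cong)
qed

lemma return_dist: "a \<in> space A \<Longrightarrow> return A a \<in> distributions A"
  by (simp add: space_prob_algebra prob_space_return)

lemma loss_return: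
  assumes "P \<in> distributions M" "a \<in> space A"
  shows "loss L P (return A a) = loss_act L P a"
  using assms by (simp add: loss_parts return_dist pos_loss_return loss_act_def ext_expect_def)

lemma return_rand_acts:
  assumes "a \<in> space A"
  shows "return A a \<in> rand_acts M A L"
  using assms return_dist[OF assms]
  by (auto simp: rand_acts_def loss_parts loss_dists_def pos_loss_return ext_defined_def)

lemma rand_actsD:
  assumes "P \<in> loss_dists M A L" "\<zeta> \<in> rand_acts M A L"
  shows "P \<in> distributions M" "\<zeta> \<in> distributions A" "loss_defined L P \<zeta>"
  using assms by (auto simp: rand_acts_def loss_dists_def)

lemma entropy_le_loss_act: "a \<in> space A \<Longrightarrow> gen_entropy A L P \<le> loss_act L P a"
  by (auto simp: gen_entropy_def intro: INF_lower)

text \<open>By Fubini, the loss of a randomized act is the average of the pure losses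
  \<open>loss_act L P a\<close>, each of which is at least the entropy.\<close>

lemma entropy_le_loss:
  assumes fin: "finite_entropy M A L P" and \<zeta>: "\<zeta> \<in> rand_acts M A L"
  shows "gen_entropy A L P \<le> loss L P \<zeta>"
proof -
  have P: "P \<in> loss_dists M A L" using fin by (simp add: finite_entropy_def)
  note D = rand_actsD[OF P \<zeta>]
  interpret P: prob_space P using D distD by blast
  interpret \<zeta>: prob_space \<zeta> using D distD by blast
  interpret pair_sigma_finite P \<zeta> ..
  have [simp]: "sets \<zeta> = sets A" "sets P = sets M" using D distD by blast+
  have sp: "space \<zeta> = space A" by (rule sets_eq_imp_space_eq) simp
  note [measurable] = L_PairD[of P \<zeta>]
  obtain c where c: "gen_entropy A L P = ereal c"
    using fin by (auto simp: finite_entropy_def)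
  have "ext_expect \<zeta> (loss_act L P) = enn2ereal (pos_loss L P \<zeta>) - enn2ereal (neg_loss L P \<zeta>)"
  proof -
    have F: "(\<integral>\<^sup>+a. \<integral>\<^sup>+x. e2ennreal (L x a) \<partial>P \<partial>\<zeta>) = pos_loss L P \<zeta>"
      "(\<integral>\<^sup>+a. \<integral>\<^sup>+x. e2ennreal (- L x a) \<partial>P \<partial>\<zeta>) = neg_loss L P \<zeta>"
      unfolding pos_loss_def by (rule Fubini'; measurable)+
    show ?thesis
      unfolding F[symmetric]
    proof (rule ext_expect_diff)
      show "(\<integral>\<^sup>+a. \<integral>\<^sup>+x. e2ennreal (L x a) \<partial>P \<partial>\<zeta>) \<noteq> \<infinity> \<or> (\<integral>\<^sup>+a. \<integral>\<^sup>+x. e2ennreal (- L x a) \<partial>P \<partial>\<zeta>) \<noteq> \<infinity>"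
        using D(3) unfolding F loss_parts(2)[OF D(1,2)] by blast
    qed (auto simp: loss_act_def ext_expect_def)
  qed
  also have "\<dots> = loss L P \<zeta>"
    using D by (simp add: loss_parts)
  finally have "ext_expect \<zeta> (loss_act L P) = loss L P \<zeta>" .
  moreover have "ext_expect \<zeta> (\<lambda>_. ereal c) = ereal c"
    using ereal_parts[of "ereal c"] by (simp add: ext_expect_def \<zeta>.emeasure_space_1)
  moreover have "ext_expect \<zeta> (\<lambda>_. ereal c) \<le> ext_expect \<zeta> (loss_act L P)"
    using entropy_le_loss_act[of _ P] c sp by (intro ext_expect_mono) auto
  ultimately show ?thesis
    using c by simp
qed

lemma ennreal_parts_finite:
  fixes p n :: ennreal
  assumes "\<bar>enn2ereal p - enn2ereal n\<bar> \<noteq> \<infinity>"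
  shows "p \<noteq> \<infinity> \<and> n \<noteq> \<infinity>"
  using assms by (cases p; cases n) auto

text \<open>The Bayes property concerns the expectation of a difference, which has to be split into
  a difference of expectations. This is possible because the pure loss is either
  \<open>\<infinity>\<close>, when the claim is trivial, or finite: finite entropy excludes
  \<open>-\<infinity>\<close>.\<close>

lemma bayes_loss_le:
  assumes fin: "finite_entropy M A L P" and b: "bayes_act M A L P \<zeta>" and a: "a \<in> space A"
  shows "loss L P \<zeta> \<le> loss_act L P a"
proof (cases "loss_act L P a = \<infinity>")
  case False
  have P: "P \<in> loss_dists M A L" using fin by (simp add: finite_entropy_def)
  have \<zeta>: "\<zeta> \<in> rand_acts M A L" using b by (simp add: bayes_act_def)
  note D = rand_actsD[OF P \<zeta>]
  have [simp]: "sets P = sets M" "space P = space M"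
    using D distD sets_eq_imp_space_eq by blast+
  let ?up = "\<lambda>x. e2ennreal (L x a)" and ?un = "\<lambda>x. e2ennreal (- L x a)"
  let ?p = "\<lambda>x. \<integral>\<^sup>+a. e2ennreal (L x a) \<partial>\<zeta>" and ?n = "\<lambda>x. \<integral>\<^sup>+a. e2ennreal (- L x a) \<partial>\<zeta>"
  note [measurable] = inner_measurable[OF \<open>sets P = sets M\<close> D(2)]
  have [measurable]: "(\<lambda>x. L x a) \<in> borel_measurable P"
    using measurable_compose[OF measurable_Pair2'[OF a] L_measurable] by (simp cong: measurable_cong_sets)
  have "loss_act L P a \<noteq> -\<infinity>"
    using entropy_le_loss_act[OF a, of P] fin by (auto simp: finite_entropy_def)
  then have U: "integral\<^sup>N P ?up \<noteq> \<infinity>" "integral\<^sup>N P ?un \<noteq> \<infinity>"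
    using False ennreal_parts_finite[of "integral\<^sup>N P ?up" "integral\<^sup>N P ?un"]
    by (auto simp: loss_act_def ext_expect_def)
  have PN: "integral\<^sup>N P ?p \<noteq> \<infinity> \<or> integral\<^sup>N P ?n \<noteq> \<infinity>"
    using D by (auto simp: loss_parts pos_loss_def)
  have pt: "loss_pt L x (return A a) = L x a" if "x \<in> space M" for x
    using a L_section[OF that, measurable]
    by (simp add: loss_pt_def ext_expect_def nn_integral_return ereal_parts)
  have ae_pn: "AE x in P. ?p x \<noteq> \<infinity> \<or> ?n x \<noteq> \<infinity>"
    using PN nn_integral_PInf_AE[of ?p P] nn_integral_PInf_AE[of ?n P]
    by (auto elim: eventually_mono)
  have ae_u: "AE x in P. ?up x \<noteq> \<infinity>" "AE x in P. ?un x \<noteq> \<infinity>"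
    by (rule nn_integral_PInf_AE; use U in simp)+
  have "AE x in P. loss_pt L x (return A a) - loss_pt L x \<zeta> =
      enn2ereal (?up x + ?n x) - enn2ereal (?un x + ?p x)"
    using ae_pn ae_u AE_space
  proof eventually_elim
    case (elim x)
    have "loss_pt L x (return A a) = enn2ereal (?up x) - enn2ereal (?un x)"
      using elim by (simp add: pt ereal_parts)
    then show ?case
      using elim by (simp add: loss_pt_def ext_expect_def flip: ennreal_diff_add_eq)
  qed
  then have "regret L P (return A a) \<zeta> = enn2ereal (\<integral>\<^sup>+x. ?up x + ?n x \<partial>P) - enn2ereal (\<integral>\<^sup>+x. ?un x + ?p x \<partial>P)"
    unfolding regret_def using U PN by (intro ext_expect_diff) (auto simp: nn_integral_add)
  moreover have "0 \<le> regret L P (return A a) \<zeta>"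
    using b return_rand_acts[OF a] by (auto simp: bayes_act_def)
  ultimately show ?thesis
    unfolding loss_parts[OF D(1,2)] loss_act_def ext_expect_def pos_loss_def
    by (intro ennreal_diff_le_diff U PN) (simp add: nn_integral_add)
qed simp

end


section \<open>Weak sequential compactness of tight sequences\<close>

lemma dense_balls_base:
  assumes "separable_space (euclidean :: 'x::metric_space topology)"
  obtains B :: "nat \<Rightarrow> 'x::metric_space set" where "\<And>k. open (B k)"
    "\<And>x \<epsilon>. 0 < \<epsilon> \<Longrightarrow> \<exists>k. x \<in> B k \<and> (\<forall>y\<in>B k. \<forall>z\<in>B k. dist y z < \<epsilon>)"
proof -
  obtain C :: "'x set" where C: "countable C" "closure C = UNIV"
    using assms by (auto simp: separable_space_def)
  define B where "B k = (let (i, m) = prod_decode k in ball (from_nat_into C i) (1 / Suc m))" for k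
  have "open (B k)" for k
    by (simp add: B_def Let_def split: prod.split)
  moreover have "\<exists>k. x \<in> B k \<and> (\<forall>y\<in>B k. \<forall>z\<in>B k. dist y z < \<epsilon>)" if "0 < \<epsilon>" for x \<epsilon>
  proof -
    have "0 < \<epsilon> / 2" using that by simp
    then obtain m where m: "1 / Suc m < \<epsilon> / 2"
      by (rule nat_approx_posE)
    have "\<exists>y\<in>C. dist y x < 1 / Suc m"
      using C(2) closure_approachable[of x C] by (simp del: of_nat_Suc)
    then obtain y where y: "y \<in> C" "dist y x < 1 / Suc m"
      by blast
    obtain i where "from_nat_into C i = y"
      using from_nat_into_surj[OF C(1) y(1)] by blast
    then have "B (prod_encode (i, m)) = ball y (1 / Suc m)"
      by (simp add: B_def)
    moreover have "dist u v < \<epsilon>" if "dist y u < 1 / Suc m" "dist y v < 1 / Suc m" for u v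
      using that m dist_triangle[of u v y] by (simp add: dist_commute)
    ultimately show ?thesis
      using y by (intro exI[of _ "prod_encode (i, m)"]) auto
  qed
  ultimately show thesis by (rule that)
qed

section \<open>Ternary expansions with digits 0 and 1\<close>

lemma ternary_summable:
  fixes b :: "nat \<Rightarrow> real"
  assumes "\<And>k. 0 \<le> b k" "\<And>k. b k \<le> 1"
  shows "summable (\<lambda>k. b k / 3 ^ k)" "0 \<le> (\<Sum>k. b k / 3 ^ k)" "(\<Sum>k. b k / 3 ^ k) \<le> 3 / 2"
proof -
  have g: "summable (\<lambda>k. (1 / 3 :: real) ^ k)" "(\<Sum>k. (1 / 3 :: real) ^ k) = 3 / 2"
    by (simp_all add: suminf_geometric)
  have le: "b k / 3 ^ k \<le> (1 / 3) ^ k" for k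
    using assms(2)[of k] by (simp add: power_divide divide_right_mono)
  show s: "summable (\<lambda>k. b k / 3 ^ k)"
    using le assms(1) by (intro summable_comparison_test'[OF g(1)]) auto
  show "0 \<le> (\<Sum>k. b k / 3 ^ k)"
    using assms(1) by (intro suminf_nonneg s) auto
  show "(\<Sum>k. b k / 3 ^ k) \<le> 3 / 2"
    using suminf_le[OF le s g(1)] g(2) by simp
qed

lemma ternary_head_tail:
  fixes b :: "nat \<Rightarrow> real"
  assumes "\<And>k. b k \<in> {0, 1}"
  shows "0 \<le> (\<Sum>k. b (Suc k) / 3 ^ k)" "(\<Sum>k. b (Suc k) / 3 ^ k) \<le> 3 / 2"
    "(\<Sum>k. b k / 3 ^ k) = b 0 + (\<Sum>k. b (Suc k) / 3 ^ k) / 3"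
proof -
  have b: "0 \<le> b k" "b k \<le> 1" for k using assms[of k] by auto
  show "0 \<le> (\<Sum>k. b (Suc k) / 3 ^ k)" "(\<Sum>k. b (Suc k) / 3 ^ k) \<le> 3 / 2"
    using ternary_summable[of "\<lambda>k. b (Suc k)"] b by auto
  have "(\<Sum>k. b (Suc k) / 3 ^ Suc k) = (\<Sum>k. b (Suc k) / 3 ^ k / 3)"
    by (simp add: mult.commute)
  also have "\<dots> = (\<Sum>k. b (Suc k) / 3 ^ k) / 3"
    using b by (intro suminf_divide ternary_summable) auto
  finally show "(\<Sum>k. b k / 3 ^ k) = b 0 + (\<Sum>k. b (Suc k) / 3 ^ k) / 3"
    using suminf_split_head[OF ternary_summable(1)[of b]] b by simp
qed

text \<open>In base 3 with digits 0 and 1, all digits after the first contribute at most 1/2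
  together, so different first digits separate the sums by at least 1/2. Base 2 would leave no
  gap.\<close>

lemma ternary_head:
  fixes b c :: "nat \<Rightarrow> real"
  assumes b: "\<And>k. b k \<in> {0, 1}" and c: "\<And>k. c k \<in> {0, 1}"
    and less: "\<bar>(\<Sum>k. b k / 3 ^ k) - (\<Sum>k. c k / 3 ^ k)\<bar> < 1 / (2 * 3 ^ n)"
  shows "b 0 = c 0"
proof -
  have "1 / (2 * 3 ^ n) \<le> (1 / 2 :: real)"
    by (simp add: divide_simps)
  then have "\<bar>(\<Sum>k. b k / 3 ^ k) - (\<Sum>k. c k / 3 ^ k)\<bar> < 1 / 2"
    using less by linarith
  moreover have "b 0 = 0 \<or> b 0 = 1" "c 0 = 0 \<or> c 0 = 1"
    using b[of 0] c[of 0] by auto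
  ultimately show ?thesis
    using ternary_head_tail[of b, OF b] ternary_head_tail[of c, OF c] by (elim disjE) linarith+
qed

text \<open>Dropping a common first digit multiplies the difference by 3, so every further digit
  costs a factor 3 in the tolerance.\<close>

lemma ternary_digits:
  fixes b c :: "nat \<Rightarrow> real"
  assumes "\<And>k. b k \<in> {0, 1}" "\<And>k. c k \<in> {0, 1}"
    and "\<bar>(\<Sum>k. b k / 3 ^ k) - (\<Sum>k. c k / 3 ^ k)\<bar> < 1 / (2 * 3 ^ n)" and "k \<le> n"
  shows "b k = c k"
  using assms
proof (induction k arbitrary: b c n)
  case (0 b c n)
  show ?case by (rule ternary_head[OF 0(1-3)])
next
  case (Suc k b c n)
  have h: "b 0 = c 0"
    by (rule ternary_head[OF Suc.prems(1-3)])
  obtain m where m: "n = Suc m"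
    using Suc.prems(4) by (cases n) auto
  have "(\<Sum>k. b k / 3 ^ k) - (\<Sum>k. c k / 3 ^ k)
      = ((\<Sum>k. b (Suc k) / 3 ^ k) - (\<Sum>k. c (Suc k) / 3 ^ k)) / 3"
    by (subst ternary_head_tail(3)[of b, OF Suc.prems(1)], subst ternary_head_tail(3)[of c, OF Suc.prems(2)])
      (simp add: h diff_divide_distrib)
  then have "\<bar>(\<Sum>k. b (Suc k) / 3 ^ k) - (\<Sum>k. c (Suc k) / 3 ^ k)\<bar>
      = 3 * \<bar>(\<Sum>k. b k / 3 ^ k) - (\<Sum>k. c k / 3 ^ k)\<bar>"
    by (simp only: abs_divide) simp
  also have "\<dots> < 3 * (1 / (2 * 3 ^ n))"
    using Suc.prems(3) by simp
  also have "3 * (1 / (2 * 3 ^ n)) = 1 / (2 * 3 ^ m :: real)"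
    by (simp add: m)
  finally have "\<bar>(\<Sum>k. b (Suc k) / 3 ^ k) - (\<Sum>k. c (Suc k) / 3 ^ k)\<bar> < 1 / (2 * 3 ^ m)" .
  then show ?case
    using Suc.IH[of "\<lambda>k. b (Suc k)" "\<lambda>k. c (Suc k)" m] Suc.prems(1,2,4) m by auto
qed

text \<open>The ternary digits of \<open>c x\<close> record which of countably many base sets contain \<open>x\<close>. The map is not
  continuous, but its inverse is, uniformly on images of compact sets; this reduces Prokhorov's theorem to
  Helly's on the real line.\<close>

lemma real_coding:
  assumes "separable_space (euclidean :: 'x::metric_space topology)"
  obtains c :: "'x::metric_space \<Rightarrow> real" where "c \<in> borel_measurable borel" "\<And>x. 0 \<le> c x" "\<And>x. c x \<le> 2"
    "\<And>K \<epsilon>. compact K \<Longrightarrow> 0 < \<epsilon> \<Longrightarrow> \<exists>\<delta>>0. \<forall>x\<in>K. \<forall>y. \<bar>c x - c y\<bar> < \<delta> \<longrightarrow> dist x y < \<epsilon>"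
proof -
  obtain B :: "nat \<Rightarrow> 'x set" where B: "\<And>k. open (B k)"
    "\<And>x \<epsilon>. 0 < \<epsilon> \<Longrightarrow> \<exists>k. x \<in> B k \<and> (\<forall>y\<in>B k. \<forall>z\<in>B k. dist y z < \<epsilon>)"
    using dense_balls_base[OF assms] by metis
  define c where "c x = (\<Sum>k. indicator (B k) x / 3 ^ k :: real)" for x
  have [measurable]: "B k \<in> sets borel" for k
    using B(1) by simp
  have "c \<in> borel_measurable borel"
    unfolding c_def by measurable
  moreover have "0 \<le> c x" "c x \<le> 2" for x
    using ternary_summable[of "\<lambda>k. indicator (B k) x"] by (auto simp: c_def)
  moreover have "\<exists>\<delta>>0. \<forall>x\<in>K. \<forall>y. \<bar>c x - c y\<bar> < \<delta> \<longrightarrow> dist x y < \<epsilon>"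
    if cpt: "compact K" and "0 < \<epsilon>" for K \<epsilon>
  proof -
    let ?J = "{k. \<forall>y\<in>B k. \<forall>z\<in>B k. dist y z < \<epsilon>}"
    have sub: "K \<subseteq> (\<Union>k\<in>?J. B k)"
      using B(2)[OF \<open>0 < \<epsilon>\<close>] by blast
    \<comment> \<open>Finitely many small base sets cover \<open>K\<close>. Codes that agree up to
      the largest index involved put \<open>y\<close> into the same small set as
      \<open>x\<close>.\<close>
    obtain J where J: "J \<subseteq> ?J" "finite J" "K \<subseteq> (\<Union>k\<in>J. B k)"
      by (rule compactE_image[OF cpt _ sub]) (use B(1) in auto)
    obtain n where n: "\<And>k. k \<in> J \<Longrightarrow> k \<le> n"
      using J(2) finite_nat_set_iff_bounded_le by auto
    have "dist x y < \<epsilon>" if x: "x \<in> K" and close: "\<bar>c x - c y\<bar> < 1 / (2 * 3 ^ n)" for x y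
    proof -
      obtain k where k: "k \<in> J" "x \<in> B k" using J(3) x by blast
      have "indicator (B k) x = (indicator (B k) y :: real)"
        using ternary_digits[of "\<lambda>k. indicator (B k) x" "\<lambda>k. indicator (B k) y" n k] close n[OF k(1)]
        by (auto simp: c_def indicator_def)
      then have "y \<in> B k" using k(2) by (auto simp: indicator_def split: if_splits)
      with k J(1) show ?thesis by blast
    qed
    then show ?thesis by (intro exI[of _ "1 / (2 * 3 ^ n)"]) auto
  qed
  ultimately show thesis by (rule that)
qed

section \<open>Closed sets under weak convergence\<close>

lemma closed_approx:
  fixes F :: "'x::metric_space set"
  assumes "closed F" "F \<noteq> {}"
  obtains f :: "nat \<Rightarrow> 'x \<Rightarrow> real" where "\<And>m. continuous_on UNIV (f m)"
    "\<And>m x. indicator F x \<le> f m x" "\<And>m x. f m x \<le> 1"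
    "\<And>N. sets N = sets borel \<Longrightarrow> finite_measure N \<Longrightarrow> (\<lambda>m. \<integral>x. f m x \<partial>N) \<longlonglongrightarrow> measure N F"
proof -
  \<comment> \<open>Lipschitz functions tending pointwise to the indicator of \<open>F\<close>. They
    need \<open>F \<noteq> {}\<close>: the distance \<open>infdist\<close> to the empty set is 0 by
    convention.\<close>
  define f where "f m x = max 0 (1 - real m * infdist x F)" for m x
  have c: "continuous_on UNIV (f m)" for m
    unfolding f_def by (intro continuous_intros)
  have F: "x \<in> F \<longleftrightarrow> infdist x F = 0" for x
    using in_closed_iff_infdist_zero[OF assms] by blast
  have le: "indicator F x \<le> f m x" "f m x \<le> 1" for m x
    using F infdist_nonneg[of x F] by (auto simp: f_def indicator_def)
  have nn: "0 \<le> f m x" for m x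
    by (simp add: f_def)
  have lim: "(\<lambda>m. f m x) \<longlonglongrightarrow> indicator F x" for x
  proof (cases "x \<in> F")
    case False
    then have "0 < infdist x F" using F infdist_nonneg[of x F] by (metis less_eq_real_def)
    then obtain k where "1 < real k * infdist x F" using reals_Archimedean3 by blast
    moreover have "real k * infdist x F \<le> real m * infdist x F" if "k \<le> m" for m
      using that \<open>0 < infdist x F\<close> by (intro mult_right_mono) auto
    ultimately have "\<forall>m\<ge>k. f m x = 0"
      by (force simp: f_def max_def)
    then have "\<forall>\<^sub>F m in sequentially. f m x = indicator F x"
      using False by (auto simp: eventually_sequentially)
    then show ?thesis
      by (rule tendsto_eventually)
  qed (simp add: f_def F)
  have "(\<lambda>m. \<integral>x. f m x \<partial>N) \<longlonglongrightarrow> measure N F" if N: "sets N = sets borel" "finite_measure N" for N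
  proof -
    interpret finite_measure N by fact
    note [measurable_cong] = N(1)
    have [measurable]: "F \<in> sets borel" using assms(1) by simp
    have [measurable]: "f m \<in> borel_measurable borel" for m
      using c by (rule borel_measurable_continuous_onI)
    have sp: "space N = UNIV" using sets_eq_imp_space_eq[OF N(1)] by simp
    have "(\<lambda>m. \<integral>x. f m x \<partial>N) \<longlonglongrightarrow> (\<integral>x. indicator F x \<partial>N)"
      by (rule integral_dominated_convergence[where w="\<lambda>_. 1"])
        (use lim le nn in auto)
    then show ?thesis by (simp add: sp)
  qed
  with c le show thesis by (intro that[of f]) auto
qed

text \<open>The closed-set half of the portmanteau theorem: continuous majorants of the indicator
  keep the lower bound in the weak limit, and then tend to the indicator.\<close>

lemma weak_conv_m_closed:
  fixes \<mu> :: "nat \<Rightarrow> real measure"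
  assumes r: "\<And>n. real_distribution (\<mu> n)" "real_distribution M" and w: "weak_conv_m \<mu> M"
    and T: "closed T" "T \<noteq> {}" and p: "\<And>n. p \<le> measure (\<mu> n) T"
  shows "p \<le> measure M T"
proof -
  obtain f :: "nat \<Rightarrow> real \<Rightarrow> real" where f: "\<And>m. continuous_on UNIV (f m)"
    "\<And>m x. indicator T x \<le> f m x" "\<And>m x. f m x \<le> 1"
    "\<And>N. sets N = sets borel \<Longrightarrow> finite_measure N \<Longrightarrow> (\<lambda>m. \<integral>x. f m x \<partial>N) \<longlonglongrightarrow> measure N T"
    using closed_approx[OF T] by metis
  have nn: "0 \<le> f m x" for m x
    using f(2)[of x m] indicator_pos_le[of T x, where 'a=real] by linarith
  have [measurable]: "T \<in> sets borel" using T(1) by simp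
  have [measurable]: "f m \<in> borel_measurable borel" for m
    using f(1) by (rule borel_measurable_continuous_onI)
  have "p \<le> (\<integral>x. f m x \<partial>M)" for m
  proof -
    have "(\<lambda>n. \<integral>x. f m x \<partial>\<mu> n) \<longlonglongrightarrow> (\<integral>x. f m x \<partial>M)"
      using f(1,3) nn
      by (intro weak_conv_imp_integral_bdd_continuous_conv[OF r w, where B=1])
        (auto simp: continuous_on_eq_continuous_at)
    then show ?thesis
    proof (rule LIMSEQ_le_const, intro exI allI impI)
      fix n
      interpret real_distribution "\<mu> n" by (rule r)
      have "measure (\<mu> n) T = (\<integral>x. indicator T x \<partial>\<mu> n)" by simp
      also have "\<dots> \<le> (\<integral>x. f m x \<partial>\<mu> n)"
        using f(2,3) nn
        by (intro integral_mono integrable_const_bound[where B=1]) auto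
      finally show "p \<le> (\<integral>x. f m x \<partial>\<mu> n)" using p[of n] by linarith
    qed
  qed
  moreover interpret M: real_distribution M by (rule r)
  have "(\<lambda>m. \<integral>x. f m x \<partial>M) \<longlonglongrightarrow> measure M T"
    by (rule f(4)) (auto intro: M.finite_measure_axioms)
  ultimately show ?thesis by (intro LIMSEQ_le_const) auto
qed

lemma integral_diff_bound:
  fixes f g :: "'b \<Rightarrow> real"
  assumes "prob_space N" and K: "K \<in> sets N" and [measurable]: "f \<in> borel_measurable N" "g \<in> borel_measurable N"
    and b: "\<And>x. \<bar>f x\<bar> \<le> b" "\<And>x. \<bar>g x\<bar> \<le> b" and eq: "\<And>x. x \<in> K \<Longrightarrow> f x = g x"
    and m: "1 - \<epsilon> \<le> measure N K"
  shows "\<bar>(\<integral>x. f x \<partial>N) - (\<integral>x. g x \<partial>N)\<bar> \<le> 2 * b * \<epsilon>"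
proof -
  interpret prob_space N by fact
  note [measurable] = K
  have b0: "0 \<le> b" using b(1)[of undefined] by linarith
  have int: "integrable N f" "integrable N g"
    by (rule integrable_const_bound[where B=b]; use b in auto)+
  have "\<bar>(\<integral>x. f x \<partial>N) - (\<integral>x. g x \<partial>N)\<bar> = \<bar>\<integral>x. f x - g x \<partial>N\<bar>"
    using int by simp
  also have "\<dots> \<le> (\<integral>x. \<bar>f x - g x\<bar> \<partial>N)"
    by (rule integral_abs_bound)
  also have "\<dots> \<le> (\<integral>x. 2 * b * indicator (space N - K) x \<partial>N)"
  proof (rule integral_mono)
    show "integrable N (\<lambda>x. \<bar>f x - g x\<bar>)"
      using int by simp
    show "integrable N (\<lambda>x. 2 * b * indicator (space N - K) x)"
      by (rule integrable_const_bound[where B="2 * b"]) (use b0 in \<open>auto simp: indicator_def\<close>)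
    fix x assume "x \<in> space N"
    then show "\<bar>f x - g x\<bar> \<le> 2 * b * indicator (space N - K) x"
      using b(1)[of x] b(2)[of x] eq[of x] by (cases "x \<in> K") auto
  qed
  also have "\<dots> = 2 * b * (1 - prob K)"
    using K by (simp add: prob_compl)
  also have "\<dots> \<le> 2 * b * \<epsilon>"
    using m b0 by (intro mult_left_mono) auto
  finally show ?thesis .
qed

text \<open>Boundedness of the codes makes their laws tight on the line, so Helly's theorem yields a
  limit law there. Tightness of \<open>Q\<close> serves the way back: it keeps the limit law on
  closures of codes of compact sets, where decoding is continuous.\<close>

theorem prokhorov_subsequence:
  fixes Q :: "nat \<Rightarrow> 'x::metric_space measure"
  assumes sep: "separable_space (euclidean :: 'x topology)"
    and Q: "\<And>n. Q n \<in> distributions borel"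
    and tight: "\<And>\<epsilon>. 0 < \<epsilon> \<Longrightarrow> \<exists>K. compact K \<and> (\<forall>n. 1 - \<epsilon> \<le> measure (Q n) K)"
  obtains r Q\<^sub>0 where "strict_mono (r :: nat \<Rightarrow> nat)" "Q\<^sub>0 \<in> distributions borel"
    "\<And>f :: 'x \<Rightarrow> real. continuous_on UNIV f \<Longrightarrow> bounded (range f) \<Longrightarrow>
      (\<lambda>n. \<integral>x. f x \<partial>Q (r n)) \<longlonglongrightarrow> (\<integral>x. f x \<partial>Q\<^sub>0)"
proof -
  obtain c :: "'x \<Rightarrow> real" where c[measurable]: "c \<in> borel_measurable borel"
    and bd: "\<And>x. 0 \<le> c x" "\<And>x. c x \<le> 2"
    and uc: "\<And>K \<epsilon>. compact K \<Longrightarrow> 0 < \<epsilon> \<Longrightarrow> \<exists>\<delta>>0. \<forall>x\<in>K. \<forall>y. \<bar>c x - c y\<bar> < \<delta> \<longrightarrow> dist x y < \<epsilon>"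
    using real_coding[OF sep] by metis
  have sQ[measurable_cong, simp]: "sets (Q n) = sets borel" and pQ: "prob_space (Q n)" for n
    using Q[of n] by (simp_all add: space_prob_algebra)
  have spQ[simp]: "space (Q n) = UNIV" for n
    using sets_eq_imp_space_eq[OF sQ[of n]] by simp
  define \<mu> where "\<mu> n = distr (Q n) borel c" for n
  have rd: "real_distribution (\<mu> n)" for n
    unfolding \<mu>_def real_distribution_def real_distribution_axioms_def
    by (auto intro: prob_space.prob_space_distr[OF pQ])
  have "Helly_Selection.tight \<mu>"
    unfolding tight_def
  proof (intro conjI allI impI rd)
    fix \<epsilon> :: real assume "0 < \<epsilon>"
    \<comment> \<open>Codes may equal 0 and the interval is open on the left, hence the endpoint
      \<open>-1\<close>.\<close>
    have "measure (\<mu> n) {-1<..2} = 1" for n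
    proof -
      have "measure (\<mu> n) {-1<..2} = measure (Q n) (c -` {-1<..2} \<inter> space (Q n))"
        by (simp add: \<mu>_def measure_distr)
      also have "c -` {-1<..2} \<inter> space (Q n) = space (Q n)"
        using bd by (auto simp: less_le_trans[of "-1" 0])
      finally show ?thesis using prob_space.prob_space[OF pQ] by simp
    qed
    then show "\<exists>a b. a < b \<and> (\<forall>n. 1 - \<epsilon> < measure (\<mu> n) {a<..b})"
      using \<open>0 < \<epsilon>\<close> by (intro exI[of _ "-1"] exI[of _ 2]) auto
  qed
  from tight_imp_convergent_subsubsequence[OF this strict_mono_id] obtain r M
    where r: "strict_mono (r :: nat \<Rightarrow> nat)" and M: "real_distribution M" and w: "weak_conv_m (\<lambda>n. \<mu> (r n)) M"
    by (auto simp: comp_def id_def)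
  interpret M: real_distribution M by fact

  \<comment> \<open>An empty \<open>K\<close> can occur only for \<open>j = 0\<close>, where the
    required mass is 0; a singleton replaces it so that \<open>T j\<close> is never empty.\<close>
  have "\<exists>K. compact K \<and> K \<noteq> {} \<and> (\<forall>n. 1 - 1 / Suc j \<le> measure (Q n) K)" for j
  proof -
    obtain K where K: "compact K" "\<And>n. 1 - 1 / Suc j \<le> measure (Q n) K"
      using tight[of "1 / Suc j"] by auto
    show ?thesis
    proof (cases "K = {}")
      case True
      have "compact {undefined :: 'x}" by simp
      moreover have "1 - 1 / Suc j \<le> measure (Q n) {undefined}" for n
        using K(2)[of n] True by (metis measure_empty measure_nonneg order_trans)
      ultimately show ?thesis by blast
    qed (use K in blast)
  qed
  then obtain K where K: "\<And>j. compact (K j)" "\<And>j. K j \<noteq> {}" "\<And>j n. 1 - 1 / Suc j \<le> measure (Q n) (K j)"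
    by metis
  define T where "T j = closure (c ` K j)" for j
  have T: "closed (T j)" "T j \<noteq> {}" for j
    using K(2)[of j] by (auto simp: T_def)
  have cT: "c x \<in> T j" if "x \<in> K j" for x j
    using that closure_subset[of "c ` K j"] by (auto simp: T_def)
  have [measurable]: "T j \<in> sets borel" "K j \<in> sets borel" for j
    using T compact_imp_closed[OF K(1)] by auto
  have cvT: "c -` T j \<in> sets borel" for j
    using measurable_sets[OF c, of "T j"] T(1)[of j] by simp
  have MT: "1 - 1 / Suc j \<le> measure M (T j)" for j
  proof (rule weak_conv_m_closed[OF rd M w T])
    fix n
    have "measure (Q (r n)) (K j) \<le> measure (Q (r n)) (c -` T j \<inter> space (Q (r n)))"
      using cT cvT prob_space.finite_measure[OF pQ]
      by (intro finite_measure.finite_measure_mono) auto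
    then show "1 - 1 / Suc j \<le> measure (\<mu> (r n)) (T j)"
      using K(3)[of j "r n"] by (simp add: \<mu>_def measure_distr)
  qed

  \<comment> \<open>\<open>?P t z\<close> says that points whose codes tend to \<open>t\<close> tend
    to \<open>z\<close>. Since \<open>uc\<close> compares points of \<open>K j\<close> with
    arbitrary points, the limit \<open>z\<close> of a single sequence in \<open>K j\<close> attracts
    all points coded near \<open>t\<close>, including those outside \<open>K j\<close>.\<close>
  let ?P = "\<lambda>t z. \<forall>\<epsilon>>0. \<exists>\<delta>>0. \<forall>x. \<bar>c x - t\<bar> < \<delta> \<longrightarrow> dist x z < \<epsilon>"
  have ex: "\<exists>z. ?P t z" if t: "t \<in> T j" for t j
  proof -
    obtain u where u: "\<And>n. u n \<in> c ` K j" "u \<longlonglongrightarrow> t"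
      using t unfolding T_def closure_sequential by blast
    have "\<forall>n. \<exists>x. x \<in> K j \<and> u n = c x"
      using u(1) by blast
    then obtain x where x: "\<And>n. x n \<in> K j" "\<And>n. u n = c (x n)"
      by metis
    have "seq_compact (K j)"
      using K(1) compact_eq_seq_compact_metric by blast
    then obtain z s where z: "strict_mono (s :: nat \<Rightarrow> nat)" "(x \<circ> s) \<longlonglongrightarrow> z"
      by (rule seq_compactE) (use x(1) in auto)
    have lim: "(\<lambda>n. c (x (s n))) \<longlonglongrightarrow> t"
      using LIMSEQ_subseq_LIMSEQ[OF u(2) z(1)] x(2) by (simp add: comp_def)
    have "\<exists>\<delta>>0. \<forall>y. \<bar>c y - t\<bar> < \<delta> \<longrightarrow> dist y z < \<epsilon>" if "0 < \<epsilon>" for \<epsilon>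
    proof -
      obtain \<delta> where \<delta>: "0 < \<delta>" "\<And>x y. x \<in> K j \<Longrightarrow> \<bar>c x - c y\<bar> < \<delta> \<Longrightarrow> dist x y < \<epsilon> / 2"
        using uc[OF K(1)[of j] half_gt_zero[OF \<open>0 < \<epsilon>\<close>]] by blast
      have "dist y z < \<epsilon>" if y: "\<bar>c y - t\<bar> < \<delta>" for y
      proof -
        have "\<forall>\<^sub>F n in sequentially. \<bar>c (x (s n)) - c y\<bar> < \<delta>"
        proof (rule order_tendstoD)
          show "(\<lambda>n. \<bar>c (x (s n)) - c y\<bar>) \<longlonglongrightarrow> \<bar>t - c y\<bar>"
            by (intro tendsto_intros lim)
        qed (use y in linarith)
        then have ev: "\<forall>\<^sub>F n in sequentially. dist y (x (s n)) \<le> \<epsilon> / 2"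
          by eventually_elim (metis \<delta>(2) x(1) dist_commute less_imp_le)
        have "(\<lambda>n. dist y (x (s n))) \<longlonglongrightarrow> dist y z"
          using z(2) by (intro tendsto_intros) (simp add: comp_def)
        then have "dist y z \<le> \<epsilon> / 2"
          using ev by (rule tendsto_upperbound) simp
        then show ?thesis using \<open>0 < \<epsilon>\<close> by linarith
      qed
      with \<delta>(1) show ?thesis by blast
    qed
    then show ?thesis by blast
  qed
  \<comment> \<open>\<open>\<phi>\<close> extends the inverse of \<open>c\<close> continuously to the closures \<open>T j\<close>, where the limit law lives.\<close>
  define \<phi> where "\<phi> t = (SOME z. ?P t z)" for t
  have \<phi>: "?P t (\<phi> t)" if "t \<in> T j" for t j
    unfolding \<phi>_def using ex[OF that] by (rule someI_ex)
  have \<phi>c: "\<phi> (c x) = x" if x: "x \<in> K j" for x j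
  proof (rule ccontr)
    assume "\<phi> (c x) \<noteq> x"
    then obtain \<delta> where "0 < \<delta>" "\<And>y. \<bar>c y - c x\<bar> < \<delta> \<Longrightarrow> dist y (\<phi> (c x)) < dist x (\<phi> (c x))"
      using \<phi>[OF cT[OF x]] by (metis zero_less_dist_iff)
    from this(2)[of x] this(1) show False by simp
  qed
  let ?T = "\<Union>j. T j"
  have cont: "continuous_on ?T \<phi>"
    unfolding continuous_on_iff
  proof (intro ballI allI impI)
    fix t and \<epsilon> :: real assume "t \<in> ?T" and "0 < \<epsilon>"
    note half = half_gt_zero[OF \<open>0 < \<epsilon>\<close>]
    obtain i where "t \<in> T i" using \<open>t \<in> ?T\<close> by blast
    from \<phi>[OF this, rule_format, OF half]
    obtain \<delta> where \<delta>: "0 < \<delta>" "\<And>x. \<bar>c x - t\<bar> < \<delta> \<Longrightarrow> dist x (\<phi> t) < \<epsilon> / 2"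
      by blast
    have "dist (\<phi> s) (\<phi> t) < \<epsilon>" if s: "s \<in> ?T" "dist s t < \<delta>" for s
    proof -
      obtain j where j: "s \<in> T j" using s by blast
      from \<phi>[OF j, rule_format, OF half]
      obtain \<eta> where \<eta>: "0 < \<eta>" "\<And>x. \<bar>c x - s\<bar> < \<eta> \<Longrightarrow> dist x (\<phi> s) < \<epsilon> / 2"
        by blast
      \<comment> \<open>A point coded close enough to \<open>s\<close> is also coded close to
        \<open>t\<close>. It links \<open>\<phi> s\<close> and \<open>\<phi> t\<close>, although
        \<open>s\<close> and \<open>t\<close> may belong to different sets
        \<open>T j\<close>.\<close>
      have "0 < min \<eta> (\<delta> - dist s t)" using s \<eta> by simp
      then have "\<exists>u\<in>c ` K j. dist u s < min \<eta> (\<delta> - dist s t)"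
        using j unfolding T_def closure_approachable by blast
      then obtain x where "\<bar>c x - s\<bar> < min \<eta> (\<delta> - dist s t)"
        by (auto simp: dist_real_def)
      then have "dist x (\<phi> s) < \<epsilon> / 2" "dist x (\<phi> t) < \<epsilon> / 2"
        using \<eta>(2)[of x] \<delta>(2)[of x] by (auto simp: dist_real_def)
      then show ?thesis
        using dist_triangle[of "\<phi> s" "\<phi> t" x] by (simp add: dist_commute)
    qed
    with \<delta>(1) show "\<exists>\<delta>>0. \<forall>s\<in>?T. dist s t < \<delta> \<longrightarrow> dist (\<phi> s) (\<phi> t) < \<epsilon>"
      by blast
  qed

  \<comment> \<open>The value off the union does not affect the limit: by \<open>MT\<close>, the
    complement of \<open>T j\<close> has mass at most \<open>1 / Suc j\<close> under
    \<open>M\<close>.\<close>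
  define \<psi> where "\<psi> t = (if t \<in> ?T then \<phi> t else undefined)" for t
  have \<psi>T: "\<psi> t = \<phi> t" if "t \<in> T j" for t j
    using that by (auto simp: \<psi>_def)
  have [measurable]: "\<psi> \<in> borel_measurable borel"
    unfolding \<psi>_def by (intro borel_measurable_continuous_on_if cont) auto
  define Q\<^sub>0 where "Q\<^sub>0 = distr M borel \<psi>"
  have "Q\<^sub>0 \<in> distributions borel"
    by (auto simp: Q\<^sub>0_def space_prob_algebra intro!: M.prob_space_distr)
  moreover have "(\<lambda>n. \<integral>x. f x \<partial>Q (r n)) \<longlonglongrightarrow> (\<integral>x. f x \<partial>Q\<^sub>0)"
    if f: "continuous_on UNIV f" and fb: "bounded (range f)" for f :: "'x \<Rightarrow> real"
  proof -
    have [measurable]: "f \<in> borel_measurable borel"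
      using f by (rule borel_measurable_continuous_onI)
    obtain b where b: "0 < b" "\<And>x. \<bar>f x\<bar> \<le> b"
      using fb unfolding bounded_pos by auto
    show ?thesis
    proof (rule LIMSEQ_I)
      fix \<epsilon> :: real assume "0 < \<epsilon>"
      \<comment> \<open>The factor 6 leaves a third of \<open>\<epsilon>\<close> for each of the two
        errors \<open>2 * b * (1 / Suc j)\<close> made outside \<open>K j\<close> and
        \<open>T j\<close>, and a third for the convergence on the line.\<close>
      have "0 < \<epsilon> / (6 * b)" using \<open>0 < \<epsilon>\<close> b(1) by simp
      then obtain j where "1 / Suc j < \<epsilon> / (6 * b)"
        by (rule nat_approx_posE)
      then have j: "2 * b * (1 / Suc j) < \<epsilon> / 3"
        using b(1) by (simp add: field_simps)
      have "continuous_on (T j) \<phi>"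
        using cont by (rule continuous_on_subset) blast
      then have "continuous_on (T j) (\<lambda>t. f (\<phi> t))"
        by (rule continuous_on_compose2[OF f]) auto
      \<comment> \<open>Weak convergence on the line is tested by functions continuous everywhere,
        whereas \<open>f (\<phi> t)\<close> is controlled only on the closed set \<open>T j\<close>;
        Tietze's theorem extends it with the same bound.\<close>
      then obtain g :: "real \<Rightarrow> real" where g: "continuous_on UNIV g"
        "\<And>t. t \<in> T j \<Longrightarrow> g t = f (\<phi> t)" "\<And>t. \<bar>g t\<bar> \<le> b"
        using Tietze[of "T j" "\<lambda>t. f (\<phi> t)" UNIV b] T(1)[of j] b by (auto simp: less_imp_le)
      have [measurable]: "g \<in> borel_measurable borel"
        using g(1) by (rule borel_measurable_continuous_onI)
      have 1: "\<bar>(\<integral>x. f x \<partial>Q n) - (\<integral>t. g t \<partial>\<mu> n)\<bar> \<le> 2 * b * (1 / Suc j)" for n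
        unfolding \<mu>_def
        by (subst integral_distr; (rule integral_diff_bound[OF pQ, of "K j"])?)
          (use b g cT \<phi>c K(3) in auto)
      have 2: "\<bar>(\<integral>t. f (\<psi> t) \<partial>M) - (\<integral>t. g t \<partial>M)\<bar> \<le> 2 * b * (1 / Suc j)"
        by (rule integral_diff_bound[OF M.prob_space_axioms, of "T j"])
          (use b g MT in \<open>auto simp: \<psi>T\<close>)
      have "(\<lambda>n. \<integral>t. g t \<partial>\<mu> (r n)) \<longlonglongrightarrow> (\<integral>t. g t \<partial>M)"
        using g(1,3)
        by (intro weak_conv_imp_integral_bdd_continuous_conv[OF rd M w, where B=b])
          (auto simp: continuous_on_eq_continuous_at)
      then obtain N where N: "\<And>n. n \<ge> N \<Longrightarrow> \<bar>(\<integral>t. g t \<partial>\<mu> (r n)) - (\<integral>t. g t \<partial>M)\<bar> < \<epsilon> / 3"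
        using LIMSEQ_D[of _ _ "\<epsilon> / 3"] \<open>0 < \<epsilon>\<close> by (metis divide_pos_pos real_norm_def zero_less_numeral)
      have "(\<integral>x. f x \<partial>Q\<^sub>0) = (\<integral>t. f (\<psi> t) \<partial>M)"
        by (simp add: Q\<^sub>0_def integral_distr)
      then have "\<bar>(\<integral>x. f x \<partial>Q (r n)) - (\<integral>x. f x \<partial>Q\<^sub>0)\<bar> < \<epsilon>" if "n \<ge> N" for n
        using 1[of "r n"] 2 N[OF that] j by linarith
      then show "\<exists>N. \<forall>n\<ge>N. norm ((\<integral>x. f x \<partial>Q (r n)) - (\<integral>x. f x \<partial>Q\<^sub>0)) < \<epsilon>"
        by auto
    qed
  qed
  ultimately show thesis
    using r by (intro that) auto
qed


section \<open>The weak Borel field and means of laws\<close>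

lemma topspace_weak_topology[simp]: "topspace weak_topology = distributions borel"
proof -
  have "distributions borel \<subseteq> topspace weak_topology"
    unfolding weak_topology_def topology_generated_by_topspace
    by (intro Union_upper CollectI exI[of _ "\<lambda>_. 0"] exI[of _ UNIV]) auto
  then show ?thesis
    unfolding weak_topology_def topology_generated_by_topspace by auto
qed

lemma openin_weak_topology:
  fixes f :: "'x::topological_space \<Rightarrow> real"
  assumes "continuous_on UNIV f" "bounded (range f)" "open U"
  shows "openin weak_topology {P \<in> distributions borel. (\<integral>x. f x \<partial>P) \<in> U}"
  unfolding weak_topology_def by (rule topology_generated_by_Basis) (use assms in blast)

text \<open>Convergence of the integrals settles the subbasic sets; induction on the generation of
  an open set does the rest.\<close>

lemma limitin_weak_topology:
  fixes Q :: "nat \<Rightarrow> 'x::topological_space measure"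
  assumes "Q\<^sub>0 \<in> distributions borel" "\<And>n. Q n \<in> distributions borel"
    and conv: "\<And>f :: 'x \<Rightarrow> real. continuous_on UNIV f \<Longrightarrow> bounded (range f) \<Longrightarrow>
      (\<lambda>n. \<integral>x. f x \<partial>Q n) \<longlonglongrightarrow> (\<integral>x. f x \<partial>Q\<^sub>0)"
  shows "limitin weak_topology Q Q\<^sub>0 sequentially"
  unfolding limitin_def
proof (intro conjI allI impI)
  fix U assume "openin weak_topology U \<and> Q\<^sub>0 \<in> U"
  then have "generate_topology_on {{P \<in> distributions borel. (\<integral>x. f x \<partial>P) \<in> U} | (f :: 'x \<Rightarrow> real) U.
        continuous_on UNIV f \<and> bounded (range f) \<and> open U} U" and "Q\<^sub>0 \<in> U"
    by (auto simp: weak_topology_def openin_topology_generated_by_iff)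
  then show "\<forall>\<^sub>F n in sequentially. Q n \<in> U"
  proof induction
    case (Int a b)
    then show ?case by (auto intro: eventually_conj)
  next
    case (UN K)
    then obtain k where k: "k \<in> K" "Q\<^sub>0 \<in> k" by blast
    show ?case
      using UN.IH[OF k] by (rule eventually_mono) (use k in blast)
  next
    case (Basis s)
    then obtain f :: "'x \<Rightarrow> real" and V where f: "continuous_on UNIV f" "bounded (range f)" "open V"
      and s: "s = {P \<in> distributions borel. (\<integral>x. f x \<partial>P) \<in> V}" by blast
    have "\<forall>\<^sub>F n in sequentially. (\<integral>x. f x \<partial>Q n) \<in> V"
      using topological_tendstoD[OF conv[OF f(1,2)] f(3)] Basis(2) s by blast
    then show ?case
      using assms(2) s by (auto elim: eventually_mono)
  qed auto
qed (use assms in simp)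

lemma openin_weak_topology_subset: "{U. openin weak_topology U} \<subseteq> Pow (distributions borel)"
  using openin_subset[of weak_topology] by auto

lemma space_weak_borel[simp]: "space weak_borel = distributions borel"
  by (simp add: weak_borel_def space_measure_of_conv)

lemma sets_weak_borel_open: "openin weak_topology U \<Longrightarrow> U \<in> sets weak_borel"
  unfolding weak_borel_def using openin_weak_topology_subset by (subst sets_measure_of) auto

lemma integral_weak_measurable:
  fixes f :: "'x::topological_space \<Rightarrow> real"
  assumes "continuous_on UNIV f" "bounded (range f)"
  shows "(\<lambda>P. \<integral>x. f x \<partial>P) \<in> borel_measurable weak_borel"
proof (rule borel_measurableI)
  fix U :: "real set" assume "open U"
  have "(\<lambda>P. \<integral>x. f x \<partial>P) -` U \<inter> space weak_borel = {P \<in> distributions borel. (\<integral>x. f x \<partial>P) \<in> U}"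
    by auto
  then show "(\<lambda>P. \<integral>x. f x \<partial>P) -` U \<inter> space weak_borel \<in> sets weak_borel"
    using sets_weak_borel_open[OF openin_weak_topology[OF assms \<open>open U\<close>]] by simp
qed

lemma closed_approx_bounded:
  fixes F :: "'x::metric_space set"
  assumes "closed F"
  obtains f :: "nat \<Rightarrow> 'x \<Rightarrow> real" where "\<And>m. continuous_on UNIV (f m)" "\<And>m. bounded (range (f m))"
    "\<And>N. N \<in> distributions borel \<Longrightarrow> (\<lambda>m. \<integral>x. f m x \<partial>N) \<longlonglongrightarrow> measure N F"
proof (cases "F = {}")
  case True
  then show thesis by (intro that[of "\<lambda>_ _. 0"]) auto
next
  case False
  obtain f :: "nat \<Rightarrow> 'x \<Rightarrow> real" where f: "\<And>m. continuous_on UNIV (f m)"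
    "\<And>m x. indicator F x \<le> f m x" "\<And>m x. f m x \<le> 1"
    "\<And>N. sets N = sets borel \<Longrightarrow> finite_measure N \<Longrightarrow> (\<lambda>m. \<integral>x. f m x \<partial>N) \<longlonglongrightarrow> measure N F"
    using closed_approx[OF assms False] by metis
  have "0 \<le> f m x" for m x
    using f(2)[of x m] indicator_pos_le[of F x, where 'a=real] by linarith
  then have "bounded (range (f m))" for m
    using f(3) by (intro boundedI[of _ 1]) auto
  then show thesis
    using f by (intro that[of f]) (auto simp: space_prob_algebra prob_space_def)
qed

text \<open>Links the weak topology with the Giry monad: closed sets form an intersection-stable
  generator, and the mass of a closed set is a limit of integrals of bounded continuous
  functions.\<close>

lemma measurable_weak_borel_prob_algebra[measurable]:
  "(\<lambda>P. P) \<in> weak_borel \<rightarrow>\<^sub>M prob_algebra (borel :: 'x::metric_space measure)"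
proof (rule measurable_prob_algebra_generated[where \<Omega>=UNIV and G="Collect closed"])
  show "sets (borel :: 'x measure) = sigma_sets UNIV (Collect closed)"
    by (subst borel_eq_closed) simp
  show "Int_stable (Collect closed :: 'x set set)"
    by (auto simp: Int_stable_def)
  fix F :: "'x set" assume "F \<in> Collect closed"
  then obtain f :: "nat \<Rightarrow> 'x \<Rightarrow> real" where f: "\<And>m. continuous_on UNIV (f m)" "\<And>m. bounded (range (f m))"
    "\<And>N. N \<in> distributions borel \<Longrightarrow> (\<lambda>m. \<integral>x. f m x \<partial>N) \<longlonglongrightarrow> measure N F"
    using closed_approx_bounded[of F] by (metis mem_Collect_eq)
  have "(\<lambda>P. measure P F) \<in> borel_measurable weak_borel"
    by (rule borel_measurable_LIMSEQ_metric[where f="\<lambda>m P. \<integral>x. f m x \<partial>P"])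
      (use f integral_weak_measurable in auto)
  then have "(\<lambda>P. ennreal (measure P F)) \<in> borel_measurable weak_borel"
    by measurable
  also have "?this \<longleftrightarrow> (\<lambda>P. emeasure P F) \<in> borel_measurable weak_borel"
    by (intro measurable_cong)
      (auto simp: space_prob_algebra prob_space_def intro!: finite_measure.emeasure_eq_measure[symmetric])
  finally show "(\<lambda>P. emeasure P F) \<in> borel_measurable weak_borel" .
qed (auto simp: space_prob_algebra)

lemma distributions_borel_eqI:
  fixes P Q :: "'x::metric_space measure"
  assumes P: "P \<in> distributions borel" and Q: "Q \<in> distributions borel"
    and eq: "\<And>f :: 'x \<Rightarrow> real. continuous_on UNIV f \<Longrightarrow> bounded (range f) \<Longrightarrow> (\<integral>x. f x \<partial>P) = (\<integral>x. f x \<partial>Q)"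
  shows "P = Q"
proof (rule measure_eqI_generator_eq[where E="Collect closed" and \<Omega>=UNIV and A="\<lambda>_. UNIV"])
  show "Int_stable (Collect closed :: 'x set set)"
    by (auto simp: Int_stable_def)
  have [simp]: "sets P = sets borel" "sets Q = sets borel" and fin: "finite_measure P" "finite_measure Q"
    using P Q by (auto simp: space_prob_algebra prob_space_def)
  show "sets P = sigma_sets UNIV (Collect closed)" "sets Q = sigma_sets UNIV (Collect closed)"
    by (simp_all, (subst borel_eq_closed, simp)+)
  show "emeasure P F = emeasure Q F" if "F \<in> Collect closed" for F
  proof -
    obtain f :: "nat \<Rightarrow> 'x \<Rightarrow> real" where f: "\<And>m. continuous_on UNIV (f m)" "\<And>m. bounded (range (f m))"
      "\<And>N. N \<in> distributions borel \<Longrightarrow> (\<lambda>m. \<integral>x. f m x \<partial>N) \<longlonglongrightarrow> measure N F"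
      using closed_approx_bounded[of F] \<open>F \<in> Collect closed\<close> by (metis mem_Collect_eq)
    have "measure P F = measure Q F"
      using f(3)[OF P] f(3)[OF Q] eq[OF f(1,2)] by (simp add: LIMSEQ_unique)
    then show ?thesis
      using fin by (simp add: finite_measure.emeasure_eq_measure)
  qed
  show "emeasure P UNIV \<noteq> \<infinity>"
    using fin(1) by (simp add: finite_measure.emeasure_finite)
qed auto

text \<open>Integrals of bounded continuous functions separate distributions, so points are weakly
  closed. This is what lets a point mass count as a prior on a model that need not be
  measurable.\<close>

lemma singleton_sets_weak_borel:
  fixes P :: "'x::metric_space measure"
  assumes P: "P \<in> distributions borel"
  shows "{P} \<in> sets weak_borel"
proof -
  let ?C = "{f :: 'x \<Rightarrow> real. continuous_on UNIV f \<and> bounded (range f)}"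
  let ?U = "\<Union>f\<in>?C. {Q \<in> distributions borel. (\<integral>x. f x \<partial>Q) \<in> - {\<integral>x. f x \<partial>P}}"
  have "openin weak_topology ?U"
  proof (intro openin_Union, clarify)
    fix f :: "'x \<Rightarrow> real" assume "continuous_on UNIV f" "bounded (range f)"
    then show "openin weak_topology {Q \<in> distributions borel. (\<integral>x. f x \<partial>Q) \<in> - {\<integral>x. f x \<partial>P}}"
      by (intro openin_weak_topology) auto
  qed
  then have "space weak_borel - ?U \<in> sets weak_borel"
    by (intro sets.compl_sets sets_weak_borel_open)
  also have "space weak_borel - ?U = {P}"
    using P distributions_borel_eqI[OF _ P] by auto
  finally show ?thesis .
qed

text \<open>Recognizing the mean as a monadic bind makes iterated integration and associativity
  available.\<close>

lemma mean_dist_eq_bind: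
  fixes \<mu> :: "'x::metric_space measure measure"
  assumes "\<mu> \<in> distributions weak_borel"
  shows "mean_dist \<mu> = \<mu> \<bind> (\<lambda>P. P)"
proof -
  have [measurable_cong]: "sets \<mu> = sets weak_borel" and "prob_space \<mu>"
    using assms by (auto simp: space_prob_algebra)
  have m: "(\<lambda>P. P) \<in> \<mu> \<rightarrow>\<^sub>M subprob_algebra (borel :: 'x measure)"
    by (rule measurable_prob_algebraD) measurable
  have ne: "space \<mu> \<noteq> {}" using \<open>prob_space \<mu>\<close> by (rule prob_space.not_empty)
  have sets: "sets (\<mu> \<bind> (\<lambda>P. P)) = sets borel"
    using sets_kernel[OF m] ne by (rule sets_bind)
  have "mean_dist \<mu> = measure_of UNIV (sets borel) (emeasure (\<mu> \<bind> (\<lambda>P. P)))"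
    unfolding mean_dist_def
    by (rule measure_of_eq) (auto simp: emeasure_bind[OF ne m] sets.sigma_sets_eq[of borel, simplified])
  also have "\<dots> = \<mu> \<bind> (\<lambda>P. P)"
    using measure_of_of_measure[of "\<mu> \<bind> (\<lambda>P. P)"] sets sets_eq_imp_space_eq[OF sets] by simp
  finally show ?thesis .
qed

lemma mean_dist_distributions:
  fixes \<mu> :: "'x::metric_space measure measure"
  assumes "\<mu> \<in> distributions weak_borel"
  shows "mean_dist \<mu> \<in> distributions borel"
  using measurable_bind_prob_space[OF measurable_const[OF assms] measurable_weak_borel_prob_algebra,
      THEN measurable_space, of undefined "count_space UNIV"]
  by (simp add: mean_dist_eq_bind[OF assms])

lemma nn_integral_mean_dist:
  fixes \<mu> :: "'x::metric_space measure measure"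
  assumes "\<mu> \<in> distributions weak_borel" "f \<in> borel_measurable borel"
  shows "(\<integral>\<^sup>+x. f x \<partial>mean_dist \<mu>) = (\<integral>\<^sup>+P. \<integral>\<^sup>+x. f x \<partial>P \<partial>\<mu>)"
proof -
  have [measurable_cong]: "sets \<mu> = sets weak_borel"
    using assms by (auto simp: space_prob_algebra)
  have "(\<lambda>P. P) \<in> \<mu> \<rightarrow>\<^sub>M subprob_algebra (borel :: 'x measure)"
    by (rule measurable_prob_algebraD) measurable
  then show ?thesis
    unfolding mean_dist_eq_bind[OF assms(1)] by (rule nn_integral_bind[OF assms(2)])
qed

text \<open>The weight \<open>t\<close> belongs to the second measure \<open>N\<close>. As a bind
  over a Bernoulli variable, the mixture commutes with means by associativity.\<close>

definition mixture :: "real \<Rightarrow> 'b measure \<Rightarrow> 'b measure \<Rightarrow> 'b measure" where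
  "mixture t M N = measure_pmf (bernoulli_pmf t) \<bind> (\<lambda>b. if b then N else M)"

lemma mixture_measurable:
  assumes "M \<in> distributions R" "N \<in> distributions R"
  shows "(\<lambda>b. if b then N else M) \<in> measure_pmf (bernoulli_pmf t) \<rightarrow>\<^sub>M prob_algebra R"
  using assms by simp

lemma mixture_distributions:
  assumes "M \<in> distributions R" "N \<in> distributions R"
  shows "mixture t M N \<in> distributions R"
proof -
  have "measure_pmf (bernoulli_pmf t) \<in> distributions (measure_pmf (bernoulli_pmf t))"
    by (simp add: space_prob_algebra measure_pmf.prob_space_axioms)
  from measurable_bind_prob_space[OF measurable_const[OF this] mixture_measurable[OF assms],
      THEN measurable_space, of undefined "count_space UNIV"]
  show ?thesis by (simp add: mixture_def)
qed

lemma nn_integral_mixture: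
  assumes "M \<in> distributions R" "N \<in> distributions R" "f \<in> borel_measurable R" "0 \<le> t" "t \<le> 1"
  shows "(\<integral>\<^sup>+x. f x \<partial>mixture t M N) = (\<integral>\<^sup>+x. f x \<partial>N) * ennreal t + (\<integral>\<^sup>+x. f x \<partial>M) * ennreal (1 - t)"
  unfolding mixture_def
  by (subst nn_integral_bind[OF assms(3) measurable_prob_algebraD[OF mixture_measurable[OF assms(1,2)]]])
    (use assms in simp)

text \<open>For lower integrals: optimal measurable minorants of \<open>f\<close> under
  \<open>M\<close> and under \<open>N\<close> may differ, but their pointwise maximum is a minorant
  that serves both at once.\<close>

lemma nn_integral_mixture_ge:
  assumes M: "M \<in> distributions R" and N: "N \<in> distributions R" and t: "0 \<le> t" "t \<le> 1"
  shows "(\<integral>\<^sup>+x. f x \<partial>N) * ennreal t + (\<integral>\<^sup>+x. f x \<partial>M) * ennreal (1 - t) \<le> (\<integral>\<^sup>+x. f x \<partial>mixture t M N)"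
proof -
  have s: "sets M = sets R" "sets N = sets R"
    using M N by (auto simp: space_prob_algebra)
  obtain g where g: "g \<in> borel_measurable M" "g \<le> f" "integral\<^sup>N M g = integral\<^sup>N M f"
    by (rule nn_integral_minorant)
  obtain h where h: "h \<in> borel_measurable N" "h \<le> f" "integral\<^sup>N N h = integral\<^sup>N N f"
    by (rule nn_integral_minorant)
  have [measurable]: "g \<in> borel_measurable R" "h \<in> borel_measurable R"
    using g(1) h(1) s by (simp_all cong: measurable_cong_sets)
  have "integral\<^sup>N N h * ennreal t + integral\<^sup>N M g * ennreal (1 - t)
      \<le> (\<integral>\<^sup>+x. max (g x) (h x) \<partial>N) * ennreal t + (\<integral>\<^sup>+x. max (g x) (h x) \<partial>M) * ennreal (1 - t)"
    by (intro add_mono mult_right_mono nn_integral_mono) auto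
  also have "\<dots> = (\<integral>\<^sup>+x. max (g x) (h x) \<partial>mixture t M N)"
    by (rule nn_integral_mixture[symmetric, OF M N _ t]) measurable
  also have "\<dots> \<le> (\<integral>\<^sup>+x. f x \<partial>mixture t M N)"
    using g(2) h(2) by (intro nn_integral_mono) (auto simp: le_fun_def)
  finally show ?thesis
    using g(3) h(3) by simp
qed

lemma integral_mixture:
  fixes f :: "'b \<Rightarrow> real"
  assumes "M \<in> distributions R" "N \<in> distributions R" "f \<in> borel_measurable R" "bounded (range f)" "0 \<le> t" "t \<le> 1"
  shows "(\<integral>x. f x \<partial>mixture t M N) = (1 - t) * (\<integral>x. f x \<partial>M) + t * (\<integral>x. f x \<partial>N)"
proof -
  obtain b where b: "\<And>x. \<bar>f x\<bar> \<le> b"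
    using assms(4) unfolding bounded_iff by auto
  have "(\<integral>x. f x \<partial>mixture t M N)
      = (\<integral>b. (\<integral>x. f x \<partial>(if b then N else M)) \<partial>measure_pmf (bernoulli_pmf t))"
    unfolding mixture_def
    using b assms(1,2) measure_pmf.finite_measure_axioms
    by (intro integral_bind[OF assms(3) _ measurable_prob_algebraD[OF mixture_measurable[OF assms(1,2)]],
          where B=b and B'=1])
      (auto simp: space_prob_algebra prob_space.emeasure_space_1)
  then show ?thesis
    using assms by (simp add: mult.commute)
qed

lemma mean_dist_mixture:
  fixes \<mu> \<nu> :: "'x::metric_space measure measure"
  assumes "\<mu> \<in> distributions weak_borel" "\<nu> \<in> distributions weak_borel"
  shows "mean_dist (mixture t \<mu> \<nu>) = mixture t (mean_dist \<mu>) (mean_dist \<nu>)"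
proof -
  have "mean_dist (mixture t \<mu> \<nu>) = measure_pmf (bernoulli_pmf t) \<bind> (\<lambda>b. (if b then \<nu> else \<mu>) \<bind> (\<lambda>P. P))"
    unfolding mean_dist_eq_bind[OF mixture_distributions[OF assms]] unfolding mixture_def
    by (rule bind_assoc[OF measurable_prob_algebraD[OF mixture_measurable[OF assms]]])
      (rule measurable_prob_algebraD[OF measurable_weak_borel_prob_algebra])
  also have "\<dots> = mixture t (mean_dist \<mu>) (mean_dist \<nu>)"
    unfolding mixture_def by (intro bind_cong refl) (simp add: mean_dist_eq_bind assms)
  finally show ?thesis .
qed

section \<open>Priors on a model: mixtures, point masses, tightness of means\<close>

lemma mixture_priors:
  assumes \<mu>: "\<mu> \<in> priors \<Omega>" and \<nu>: "\<nu> \<in> priors \<Omega>" and t: "0 \<le> t" "t \<le> 1"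
  shows "mixture t \<mu> \<nu> \<in> priors \<Omega>"
proof -
  have d: "\<mu> \<in> distributions weak_borel" "\<nu> \<in> distributions weak_borel"
    using \<mu> \<nu> by (auto simp: priors_def)
  have s: "sets \<mu> = sets weak_borel" "sets \<nu> = sets weak_borel" "sets (mixture t \<mu> \<nu>) = sets weak_borel"
    using d mixture_distributions[OF d, of t] by (auto simp: space_prob_algebra)
  then have sp: "space \<mu> = space weak_borel" "space \<nu> = space weak_borel" "space (mixture t \<mu> \<nu>) = space weak_borel"
    using sets_eq_imp_space_eq by blast+
  obtain A where A: "{\<theta> \<in> space \<mu>. \<theta> \<notin> \<Omega>} \<subseteq> A" "A \<in> null_sets \<mu>"
    using \<mu> by (auto simp: priors_def eventually_ae_filter)
  obtain B where B: "{\<theta> \<in> space \<nu>. \<theta> \<notin> \<Omega>} \<subseteq> B" "B \<in> null_sets \<nu>"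
    using \<nu> by (auto simp: priors_def eventually_ae_filter)
  have m: "A \<in> sets weak_borel" "B \<in> sets weak_borel"
    using null_setsD2[OF A(2)] null_setsD2[OF B(2)] s by auto
  \<comment> \<open>As \<open>\<Omega>\<close> need not be measurable, its complement is enclosed in
    exceptional sets of \<open>\<mu>\<close> and of \<open>\<nu>\<close>; their intersection still
    encloses it and is null for both.\<close>
  have "emeasure \<mu> (A \<inter> B) = 0" "emeasure \<nu> (A \<inter> B) = 0"
    using null_set_Int2[OF A(2), of B] null_set_Int1[OF B(2), of A] m s by auto
  then have "emeasure (mixture t \<mu> \<nu>) (A \<inter> B) = 0"
    using nn_integral_mixture[OF d, of "indicator (A \<inter> B)" t] m t s by simp
  then have "A \<inter> B \<in> null_sets (mixture t \<mu> \<nu>)"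
    using m s by auto
  then have "AE \<theta> in mixture t \<mu> \<nu>. \<theta> \<in> \<Omega>"
    by (rule AE_I') (use A(1) B(1) sp in auto)
  then show ?thesis
    using mixture_distributions[OF d] by (simp add: priors_def)
qed

lemma return_priors:
  fixes \<omega> :: "'x::metric_space measure"
  assumes "\<omega> \<in> distributions borel" "\<omega> \<in> \<Omega>"
  shows "return weak_borel \<omega> \<in> priors \<Omega>" "mean_dist (return weak_borel \<omega>) = \<omega>"
proof -
  have d: "return weak_borel \<omega> \<in> distributions weak_borel"
    using assms(1) by (simp add: space_prob_algebra prob_space_return)
  have m: "{\<omega>} \<in> sets weak_borel"
    using assms(1) by (rule singleton_sets_weak_borel)
  have "Measurable.pred weak_borel (\<lambda>\<theta>. \<theta> \<in> {\<omega>})"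
    using m by (rule pred_sets2) simp
  then have "AE \<theta> in return weak_borel \<omega>. \<theta> \<in> {\<omega>}"
    using assms(1) by (subst AE_return) auto
  then have "AE \<theta> in return weak_borel \<omega>. \<theta> \<in> \<Omega>"
    by eventually_elim (use assms(2) in auto)
  with d show "return weak_borel \<omega> \<in> priors \<Omega>"
    by (simp add: priors_def)
  show "mean_dist (return weak_borel \<omega>) = \<omega>"
    unfolding mean_dist_eq_bind[OF d]
    by (rule bind_return[OF measurable_prob_algebraD[OF measurable_weak_borel_prob_algebra]])
      (use assms(1) in simp)
qed

text \<open>Carries tightness from the model to the means of its priors, with the same compact
  sets.\<close>

lemma mean_dist_measure_ge:
  fixes \<mu> :: "'x::metric_space measure measure"
  assumes \<mu>: "\<mu> \<in> priors \<Omega>" and C: "C \<in> sets borel" and le: "\<And>P. P \<in> \<Omega> \<Longrightarrow> p \<le> measure P C"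
  shows "p \<le> measure (mean_dist \<mu>) C"
proof -
  have d: "\<mu> \<in> distributions weak_borel" using \<mu> by (simp add: priors_def)
  have s: "sets (mean_dist \<mu>) = sets borel" and "prob_space (mean_dist \<mu>)" and "prob_space \<mu>"
    using mean_dist_distributions[OF d] d by (auto simp: space_prob_algebra)
  interpret \<mu>: prob_space \<mu> by fact
  interpret P: prob_space "mean_dist \<mu>" by fact
  have ae: "AE P in \<mu>. P \<in> \<Omega> \<and> P \<in> distributions borel"
    using \<mu> AE_space[of \<mu>] sets_eq_imp_space_eq[of \<mu> weak_borel] d
    by (auto simp: priors_def space_prob_algebra)
  have "ennreal p = (\<integral>\<^sup>+P. ennreal p \<partial>\<mu>)"
    by (simp add: \<mu>.emeasure_space_1)
  also have "\<dots> \<le> (\<integral>\<^sup>+P. \<integral>\<^sup>+x. indicator C x \<partial>P \<partial>\<mu>)"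
  proof (rule nn_integral_mono_AE)
    show "AE P in \<mu>. ennreal p \<le> (\<integral>\<^sup>+x. indicator C x \<partial>P)"
      using ae
    proof eventually_elim
      case (elim P)
      then interpret Q: prob_space P by (simp add: space_prob_algebra)
      show ?case
        using elim le[of P] C by (simp add: space_prob_algebra Q.emeasure_eq_measure ennreal_leI)
    qed
  qed
  also have "\<dots> = emeasure (mean_dist \<mu>) C"
    using nn_integral_mean_dist[OF d, of "indicator C"] C s by simp
  finally show ?thesis
    by (simp add: P.emeasure_eq_measure)
qed


section \<open>The derived game\<close>

text \<open>The identity \<open>d = p - n - h\<close> for the derived loss, rewritten as
  \<open>n + C + d = p + (C - h)\<close>: every term is now nonnegative and can be integrated
  separately. \<open>ennreal_collect_loss\<close> undoes the rewriting after integration.\<close>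

lemma ennreal_split_loss:
  fixes p n :: ennreal
  assumes "0 \<le> enn2ereal p - enn2ereal n - ereal h" "n \<noteq> \<infinity>" "h \<le> C" "0 \<le> C"
  shows "(n + ennreal C) + e2ennreal (enn2ereal p - enn2ereal n - ereal h) = p + e2ennreal (ereal C - ereal h)"
proof -
  obtain n' where n: "n = ennreal n'" "0 \<le> n'"
    using assms(2) by (cases n) auto
  show ?thesis
  proof (cases p)
    case (real p')
    have le: "0 \<le> p' - n' - h"
      using assms(1) real n by simp
    have "(n + ennreal C) + e2ennreal (enn2ereal p - enn2ereal n - ereal h)
        = ennreal n' + ennreal C + ennreal (p' - n' - h)"
      using real n by simp
    also have "\<dots> = ennreal (n' + C + (p' - n' - h))"
      using le n assms(4) by (subst ennreal_plus; simp)+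
    also have "n' + C + (p' - n' - h) = p' + (C - h)" by simp
    also have "ennreal \<dots> = p + e2ennreal (ereal C - ereal h)"
      using real assms(3) by (subst ennreal_plus) auto
    finally show ?thesis .
  qed (use n in \<open>simp add: top_ereal_def\<close>)
qed

lemma ennreal_collect_loss:
  fixes p n d :: ennreal
  assumes eq: "(n + ennreal C) + d = p + ennreal v" and "n \<noteq> \<infinity>" "0 \<le> C" "0 \<le> v"
  shows "enn2ereal d = enn2ereal p - enn2ereal n - ereal (C - v)"
proof -
  obtain n' where n: "n = ennreal n'" "0 \<le> n'"
    using assms(2) by (cases n) auto
  have "enn2ereal ((n + ennreal C) + d) = enn2ereal (p + ennreal v)"
    using eq by simp
  then have "ereal n' + ereal C + enn2ereal d = enn2ereal p + ereal v"
    using n assms(3,4) by (simp add: plus_ennreal.rep_eq)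
  then show ?thesis
    using n by (cases d; cases p) auto
qed

text \<open>The entropy bound \<open>C\<close> is taken nonnegative because it enters nonnegative
  integrals as \<open>ennreal C\<close>, which would truncate a negative value.\<close>

locale robust_game = game "borel :: 'x::metric_space measure" A L
  for A :: "'a measure" and L :: "'x::metric_space \<Rightarrow> 'a \<Rightarrow> ereal" +
  fixes \<Omega> :: "'x measure set" and K C :: real
  assumes model: "\<Omega> \<subseteq> distributions borel"
    and finite: "\<And>P. P \<in> mixtures \<Omega> \<Longrightarrow> finite_entropy borel A L P"
    and bayes_ex: "\<And>P. P \<in> mixtures \<Omega> \<Longrightarrow> \<exists>\<zeta>. bayes_act borel A L P \<zeta>"
    and upper: "\<And>P. P \<in> mixtures \<Omega> \<Longrightarrow> gen_entropy A L P \<le> ereal C"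
    and lower: "\<And>\<omega>. \<omega> \<in> \<Omega> \<Longrightarrow> ereal K \<le> gen_entropy A L \<omega>"
    and C_nonneg: "0 \<le> C"
begin

abbreviation acts :: "'a measure set" where
  "acts \<equiv> rand_acts borel A L"

lemma priorsD: "\<mu> \<in> priors \<Omega> \<Longrightarrow> \<mu> \<in> distributions weak_borel"
  by (simp add: priors_def)

lemma actsD: "\<zeta> \<in> acts \<Longrightarrow> \<zeta> \<in> distributions A"
  by (simp add: rand_acts_def)

lemma model_mixtures: "\<Omega> \<subseteq> mixtures \<Omega>"
proof
  fix \<omega> assume "\<omega> \<in> \<Omega>"
  then have "return weak_borel \<omega> \<in> priors \<Omega>" "mean_dist (return weak_borel \<omega>) = \<omega>"
    using return_priors[of \<omega> \<Omega>] model by auto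
  then show "\<omega> \<in> mixtures \<Omega>"
    by (force simp: mixtures_def)
qed

lemma mean_mixtures: "\<mu> \<in> priors \<Omega> \<Longrightarrow> mean_dist \<mu> \<in> mixtures \<Omega>"
  by (simp add: mixtures_def)

lemma derived_loss_eq:
  assumes "\<omega> \<in> \<Omega>"
  shows "derived_loss A L \<omega> \<zeta> = loss L \<omega> \<zeta> - gen_entropy A L \<omega>"
  using finite[of \<omega>] model_mixtures assms by (auto simp: derived_loss_def discrepancy_def)

lemma derived_loss_nonneg:
  assumes "\<omega> \<in> \<Omega>" "\<zeta> \<in> acts"
  shows "0 \<le> derived_loss A L \<omega> \<zeta>"
proof -
  have "finite_entropy borel A L \<omega>"
    using finite model_mixtures assms(1) by blast
  then have "gen_entropy A L \<omega> \<le> loss L \<omega> \<zeta>" "\<bar>gen_entropy A L \<omega>\<bar> \<noteq> \<infinity>"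
    using entropy_le_loss assms(2) by (auto simp: finite_entropy_def)
  then show ?thesis
    unfolding derived_loss_eq[OF assms(1)] by (cases "gen_entropy A L \<omega>"; cases "loss L \<omega> \<zeta>") auto
qed

lemma derived_loss_law_nn_integral:
  assumes "\<mu> \<in> priors \<Omega>" "\<zeta> \<in> acts"
  shows "derived_loss_law A L \<mu> \<zeta> = enn2ereal (\<integral>\<^sup>+\<theta>. e2ennreal (derived_loss A L \<theta> \<zeta>) \<partial>\<mu>)"
  unfolding derived_loss_law_def using assms derived_loss_nonneg
  by (intro ext_expect_nonneg) (auto simp: priors_def elim!: eventually_mono)

text \<open>This direction turns a bound on the loss against a mixture into a bound on the loss
  against its components.\<close>

lemma mixture_loss_ge:
  assumes "\<mu> \<in> priors \<Omega>" "\<nu> \<in> priors \<Omega>" "\<zeta> \<in> acts" "0 \<le> t" "t \<le> 1"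
  shows "ereal t * derived_loss_law A L \<nu> \<zeta> + ereal (1 - t) * derived_loss_law A L \<mu> \<zeta>
    \<le> derived_loss_law A L (mixture t \<mu> \<nu>) \<zeta>"
proof -
  let ?d = "\<lambda>\<theta>. e2ennreal (derived_loss A L \<theta> \<zeta>)"
  have "integral\<^sup>N \<nu> ?d * ennreal t + integral\<^sup>N \<mu> ?d * ennreal (1 - t) \<le> integral\<^sup>N (mixture t \<mu> \<nu>) ?d"
    by (rule nn_integral_mixture_ge[OF priorsD priorsD]) (use assms in auto)
  then show ?thesis
    using assms mixture_priors[OF assms(1,2,4,5)]
    by (simp add: derived_loss_law_nn_integral less_eq_ennreal.rep_eq plus_ennreal.rep_eq
        times_ennreal.rep_eq mult.commute)
qed

section \<open>Averaging the derived loss over a law\<close>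

lemma pos_loss_mean:
  assumes \<mu>: "\<mu> \<in> distributions weak_borel" and \<zeta>: "\<zeta> \<in> distributions A"
  shows "pos_loss L (mean_dist \<mu>) \<zeta> = (\<integral>\<^sup>+\<theta>. pos_loss L \<theta> \<zeta> \<partial>\<mu>)"
    "neg_loss L (mean_dist \<mu>) \<zeta> = (\<integral>\<^sup>+\<theta>. neg_loss L \<theta> \<zeta> \<partial>\<mu>)"
    "(\<lambda>\<theta>. pos_loss L \<theta> \<zeta>) \<in> borel_measurable \<mu>" "(\<lambda>\<theta>. neg_loss L \<theta> \<zeta>) \<in> borel_measurable \<mu>"
proof -
  note m = inner_measurable[OF refl \<zeta>]
  show "pos_loss L (mean_dist \<mu>) \<zeta> = (\<integral>\<^sup>+\<theta>. pos_loss L \<theta> \<zeta> \<partial>\<mu>)"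
    "neg_loss L (mean_dist \<mu>) \<zeta> = (\<integral>\<^sup>+\<theta>. neg_loss L \<theta> \<zeta> \<partial>\<mu>)"
    unfolding pos_loss_def by (rule nn_integral_mean_dist[OF \<mu>] m)+
  have [measurable_cong]: "sets \<mu> = sets weak_borel"
    using \<mu> by (auto simp: space_prob_algebra)
  have k: "(\<lambda>P. P) \<in> \<mu> \<rightarrow>\<^sub>M subprob_algebra (borel :: 'x measure)"
    by (rule measurable_prob_algebraD) measurable
  show "(\<lambda>\<theta>. pos_loss L \<theta> \<zeta>) \<in> borel_measurable \<mu>" "(\<lambda>\<theta>. neg_loss L \<theta> \<zeta>) \<in> borel_measurable \<mu>"
    unfolding pos_loss_def
    by (rule measurable_compose[OF k nn_integral_measurable_subprob_algebra] m)+
qed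

text \<open>The constant \<open>c\<close> is the upper integral of the entropy, which need not be measurable.\<close>

lemma derived_loss_law_eq:
  assumes \<mu>: "\<mu> \<in> priors \<Omega>"
  obtains c where "K \<le> c"
    "\<And>\<zeta>. \<zeta> \<in> acts \<Longrightarrow> derived_loss_law A L \<mu> \<zeta> = loss L (mean_dist \<mu>) \<zeta> - ereal c"
proof -
  note d = priorsD[OF \<mu>]
  interpret \<mu>: prob_space \<mu> using d by (simp add: space_prob_algebra)
  let ?P = "mean_dist \<mu>"
  have fin: "finite_entropy borel A L ?P"
    using finite mean_mixtures[OF \<mu>] by blast
  have ae: "AE \<theta> in \<mu>. \<theta> \<in> \<Omega>"
    using \<mu> by (simp add: priors_def)
  have H: "\<exists>h. gen_entropy A L \<theta> = ereal h \<and> K \<le> h \<and> h \<le> C" if "\<theta> \<in> \<Omega>" for \<theta>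
    using upper[of \<theta>] lower[OF that] model_mixtures that
    by (cases "gen_entropy A L \<theta>") auto
  \<comment> \<open>A lower integral of \<open>C - H\<close>, so \<open>C - v\<close> is the upper
    integral of the entropy. It is finite by the two entropy bounds and does not involve the
    act.\<close>
  define V where "V = (\<integral>\<^sup>+\<theta>. e2ennreal (ereal C - gen_entropy A L \<theta>) \<partial>\<mu>)"
  have "V \<le> (\<integral>\<^sup>+\<theta>. ennreal (C - K) \<partial>\<mu>)"
    unfolding V_def using ae
    by (intro nn_integral_mono_AE) (auto elim!: eventually_mono dest!: H intro!: ennreal_leI)
  then have "V \<le> ennreal (C - K)"
    by (simp add: \<mu>.emeasure_space_1)
  moreover have "K \<le> C"
    using H ae \<mu>.AE_False \<mu>.emeasure_space_1 by (metis (mono_tags, lifting) eventually_mono order_trans)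
  ultimately obtain v where v: "V = ennreal v" "0 \<le> v" "v \<le> C - K"
    by (cases V) (auto simp: top_unique)
  have "derived_loss_law A L \<mu> \<zeta> = loss L ?P \<zeta> - ereal (C - v)" if \<zeta>: "\<zeta> \<in> acts" for \<zeta>
  proof -
    note \<zeta>' = actsD[OF \<zeta>]
    note [measurable] = pos_loss_mean(3,4)[OF d \<zeta>']
    have P: "?P \<in> distributions borel"
      using d by (rule mean_dist_distributions)
    have "loss L ?P \<zeta> \<noteq> -\<infinity>"
      using entropy_le_loss[OF fin \<zeta>] fin by (auto simp: finite_entropy_def)
    moreover have "loss_defined L ?P \<zeta>"
      using fin \<zeta> rand_actsD by (auto simp: finite_entropy_def)
    \<comment> \<open>Finite entropy of the mean bounds the loss from below; as the loss is defined,
      its negative part is finite and may later be subtracted.\<close>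
    ultimately have neg: "neg_loss L ?P \<zeta> \<noteq> \<infinity>"
      unfolding loss_parts[OF P \<zeta>'] by (cases "pos_loss L ?P \<zeta>"; cases "neg_loss L ?P \<zeta>") auto
    then have "AE \<theta> in \<mu>. neg_loss L \<theta> \<zeta> \<noteq> \<infinity>"
      unfolding pos_loss_mean[OF d \<zeta>'] by (intro nn_integral_PInf_AE) auto
    with ae have "AE \<theta> in \<mu>. (neg_loss L \<theta> \<zeta> + ennreal C) + e2ennreal (derived_loss A L \<theta> \<zeta>)
        = pos_loss L \<theta> \<zeta> + e2ennreal (ereal C - gen_entropy A L \<theta>)"
    proof eventually_elim
      case (elim \<theta>)
      then obtain h where h: "gen_entropy A L \<theta> = ereal h" "h \<le> C" using H by blast
      have eq: "derived_loss A L \<theta> \<zeta> = enn2ereal (pos_loss L \<theta> \<zeta>) - enn2ereal (neg_loss L \<theta> \<zeta>) - ereal h"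
        using derived_loss_eq[OF elim(1)] loss_parts(1)[OF _ \<zeta>'] model elim(1) h by auto
      show ?case
        using derived_loss_nonneg[OF elim(1) \<zeta>] elim(2) h(2) C_nonneg unfolding eq h(1)
        by (rule ennreal_split_loss)
    qed
    \<comment> \<open>On each side at most the last summand can fail to be measurable, so
      \<open>nn_integral_add_lower\<close> splits both lower integrals.\<close>
    then have "(\<integral>\<^sup>+\<theta>. (neg_loss L \<theta> \<zeta> + ennreal C) + e2ennreal (derived_loss A L \<theta> \<zeta>) \<partial>\<mu>)
        = (\<integral>\<^sup>+\<theta>. pos_loss L \<theta> \<zeta> + e2ennreal (ereal C - gen_entropy A L \<theta>) \<partial>\<mu>)"
      by (rule nn_integral_cong_AE)
    then have "(neg_loss L ?P \<zeta> + ennreal C) + (\<integral>\<^sup>+\<theta>. e2ennreal (derived_loss A L \<theta> \<zeta>) \<partial>\<mu>)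
        = pos_loss L ?P \<zeta> + ennreal v"
      by (simp add: nn_integral_add_lower nn_integral_add pos_loss_mean[OF d \<zeta>'] \<mu>.emeasure_space_1
          V_def[symmetric] v(1))
    from ennreal_collect_loss[OF this neg C_nonneg v(2)] show ?thesis
      using \<mu> \<zeta> by (simp add: derived_loss_law_nn_integral loss_parts[OF P \<zeta>'])
  qed
  then show thesis
    using v by (intro that[of "C - v"]) auto
qed

lemma derived_loss_law_nonneg:
  "\<mu> \<in> priors \<Omega> \<Longrightarrow> \<zeta> \<in> acts \<Longrightarrow> 0 \<le> derived_loss_law A L \<mu> \<zeta>"
  by (simp add: derived_loss_law_nn_integral)

text \<open>Against a fixed law, derived and basic loss differ by the constant \<open>c\<close> of
  \<open>derived_loss_law_eq\<close>, so optimality transfers between the games. Since the derived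
  loss is nonnegative and \<open>K \<le> c\<close>, the mean inherits the lower entropy bound
  \<open>K\<close>, as admissible sequences require.\<close>

lemma derived_entropy_bounds:
  assumes \<mu>: "\<mu> \<in> priors \<Omega>"
  shows "0 \<le> derived_entropy A L \<mu>" "derived_entropy A L \<mu> \<le> ereal (C - K)"
    "ereal K \<le> gen_entropy A L (mean_dist \<mu>)"
    "\<zeta> \<in> acts \<Longrightarrow> derived_entropy A L \<mu> \<le> derived_loss_law A L \<mu> \<zeta>"
    "bayes_act borel A L (mean_dist \<mu>) \<zeta> \<Longrightarrow> derived_loss_law A L \<mu> \<zeta> \<le> derived_entropy A L \<mu>"
proof -
  let ?P = "mean_dist \<mu>"
  obtain c where c: "K \<le> c"
    "\<And>\<zeta>. \<zeta> \<in> acts \<Longrightarrow> derived_loss_law A L \<mu> \<zeta> = loss L ?P \<zeta> - ereal c"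
    using derived_loss_law_eq[OF \<mu>] by metis
  have P: "?P \<in> distributions borel"
    using mean_dist_distributions[OF priorsD[OF \<mu>]] .
  have fin: "finite_entropy borel A L ?P"
    using finite mean_mixtures[OF \<mu>] by blast
  have pure: "derived_loss_law A L \<mu> (return A a) = loss_act L ?P a - ereal c" if "a \<in> space A" for a
    using c(2)[OF return_rand_acts[OF that]] loss_return[OF P that] by simp
  show nonneg: "0 \<le> derived_entropy A L \<mu>"
    unfolding derived_entropy_def using derived_loss_law_nonneg[OF \<mu> return_rand_acts]
    by (intro INF_greatest)
  have le: "derived_entropy A L \<mu> + ereal c \<le> gen_entropy A L ?P"
    unfolding gen_entropy_def
  proof (rule INF_greatest)
    fix a assume a: "a \<in> space A"
    have "derived_entropy A L \<mu> \<le> loss_act L ?P a - ereal c"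
      unfolding derived_entropy_def using a pure[OF a] by (metis INF_lower)
    then show "derived_entropy A L \<mu> + ereal c \<le> loss_act L ?P a"
      by (simp add: ereal_le_minus)
  qed
  have "derived_entropy A L \<mu> + ereal c \<le> ereal C"
    using le upper[OF mean_mixtures[OF \<mu>]] by simp
  then show "derived_entropy A L \<mu> \<le> ereal (C - K)"
    using c(1) by (cases "derived_entropy A L \<mu>") auto
  have "ereal c \<le> derived_entropy A L \<mu> + ereal c"
    using add_right_mono[OF nonneg, of "ereal c"] by simp
  then show "ereal K \<le> gen_entropy A L ?P"
    using c(1) le by (meson ereal_less_eq(3) order_trans)
  show "derived_entropy A L \<mu> \<le> derived_loss_law A L \<mu> \<zeta>" if "\<zeta> \<in> acts" for \<zeta>
    using order_trans[OF le entropy_le_loss[OF fin that]] c(2)[OF that] by (simp add: ereal_le_minus)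
  show "derived_loss_law A L \<mu> \<zeta> \<le> derived_entropy A L \<mu>" if b: "bayes_act borel A L ?P \<zeta>" for \<zeta>
    unfolding derived_entropy_def
  proof (rule INF_greatest)
    fix a assume a: "a \<in> space A"
    have "\<zeta> \<in> acts" using b by (simp add: bayes_act_def)
    then show "derived_loss_law A L \<mu> \<zeta> \<le> derived_loss_law A L \<mu> (return A a)"
      unfolding pure[OF a] c(2)[OF \<open>\<zeta> \<in> acts\<close>]
      by (intro ereal_minus_mono bayes_loss_le[OF fin b a] order_refl)
  qed
qed

text \<open>An average cannot exceed the supremum, and point masses reproduce every single
  value.\<close>

lemma sup_derived_loss:
  assumes \<zeta>: "\<zeta> \<in> acts"
  shows "(SUP \<mu>\<in>priors \<Omega>. derived_loss_law A L \<mu> \<zeta>) = (SUP \<omega>\<in>\<Omega>. derived_loss A L \<omega> \<zeta>)"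
proof (rule antisym)
  show "(SUP \<mu>\<in>priors \<Omega>. derived_loss_law A L \<mu> \<zeta>) \<le> (SUP \<omega>\<in>\<Omega>. derived_loss A L \<omega> \<zeta>)" (is "_ \<le> ?S")
  proof (rule SUP_least)
    fix \<mu> assume \<mu>: "\<mu> \<in> priors \<Omega>"
    interpret \<mu>: prob_space \<mu> using priorsD[OF \<mu>] by (simp add: space_prob_algebra)
    have ae: "AE \<theta> in \<mu>. \<theta> \<in> \<Omega>"
      using \<mu> by (simp add: priors_def)
    then have "\<exists>\<theta>. \<theta> \<in> \<Omega>"
      using \<mu>.AE_False by (metis (mono_tags, lifting) eventually_mono)
    then have S: "0 \<le> ?S"
      using derived_loss_nonneg[OF _ \<zeta>] by (meson SUP_upper2)
    have "(\<integral>\<^sup>+\<theta>. e2ennreal (derived_loss A L \<theta> \<zeta>) \<partial>\<mu>) \<le> (\<integral>\<^sup>+\<theta>. e2ennreal ?S \<partial>\<mu>)"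
      using ae by (intro nn_integral_mono_AE) (auto elim!: eventually_mono intro!: e2ennreal_mono SUP_upper)
    then have "(\<integral>\<^sup>+\<theta>. e2ennreal (derived_loss A L \<theta> \<zeta>) \<partial>\<mu>) \<le> e2ennreal ?S"
      by (simp add: \<mu>.emeasure_space_1)
    then show "derived_loss_law A L \<mu> \<zeta> \<le> ?S"
      using S by (simp add: derived_loss_law_nn_integral[OF \<mu> \<zeta>] less_eq_ennreal.rep_eq enn2ereal_e2ennreal)
  qed
  show "?S \<le> (SUP \<mu>\<in>priors \<Omega>. derived_loss_law A L \<mu> \<zeta>)"
  proof (rule SUP_mono)
    fix \<omega> assume \<omega>: "\<omega> \<in> \<Omega>"
    then have "\<omega> \<in> distributions borel" using model by blast
    note R = return_priors[OF this \<omega>]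
    \<comment> \<open>With the singleton model \<open>{\<omega>}\<close>, concentration on the model
      becomes almost sure equality, so the possibly nonmeasurable integrand can be replaced by a
      constant.\<close>
    have ae: "AE \<theta> in return weak_borel \<omega>. \<theta> = \<omega>"
      using return_priors(1)[OF \<open>\<omega> \<in> distributions borel\<close>, of "{\<omega>}"] by (simp add: priors_def)
    have "derived_loss_law A L (return weak_borel \<omega>) \<zeta>
        = enn2ereal (\<integral>\<^sup>+\<theta>. e2ennreal (derived_loss A L \<omega> \<zeta>) \<partial>return weak_borel \<omega>)"
      unfolding derived_loss_law_nn_integral[OF R(1) \<zeta>]
      using ae by (intro arg_cong[of _ _ enn2ereal] nn_integral_cong_AE) (auto elim: eventually_mono)
    also have "\<dots> = derived_loss A L \<omega> \<zeta>"
      using derived_loss_nonneg[OF \<omega> \<zeta>] prob_space.emeasure_space_1[OF prob_space_return[of \<omega> weak_borel]]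
        \<open>\<omega> \<in> distributions borel\<close>
      by (simp add: enn2ereal_e2ennreal)
    finally show "\<exists>\<mu>\<in>priors \<Omega>. derived_loss A L \<omega> \<zeta> \<le> derived_loss_law A L \<mu> \<zeta>"
      using R(1) by (metis order_refl)
  qed
qed

lemma mean_admissible:
  assumes \<kappa>: "\<And>n. \<kappa> n \<in> priors \<Omega>" and Q: "Q\<^sub>0 \<in> distributions borel"
    and conv: "\<And>f :: 'x \<Rightarrow> real. continuous_on UNIV f \<Longrightarrow> bounded (range f) \<Longrightarrow>
      (\<lambda>n. \<integral>x. f x \<partial>mean_dist (\<kappa> n)) \<longlonglongrightarrow> (\<integral>x. f x \<partial>Q\<^sub>0)"
  shows "admissible_seq A L (mixtures \<Omega>) (\<lambda>n. mean_dist (\<kappa> n)) Q\<^sub>0"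
  unfolding admissible_seq_def
proof (intro conjI allI)
  show "mean_dist (\<kappa> n) \<in> mixtures \<Omega>" "\<exists>\<zeta>. bayes_act borel A L (mean_dist (\<kappa> n)) \<zeta>" for n
    using mean_mixtures[OF \<kappa>] bayes_ex by auto
  show "\<exists>b::real. \<forall>n. ereal b \<le> gen_entropy A L (mean_dist (\<kappa> n))"
    using derived_entropy_bounds(3)[OF \<kappa>] by blast
  show "limitin weak_topology (\<lambda>n. mean_dist (\<kappa> n)) Q\<^sub>0 sequentially"
    by (rule limitin_weak_topology[OF Q mean_dist_distributions[OF priorsD[OF \<kappa>]] conv])
qed

text \<open>If \<open>\<mu> n\<close> is \<open>\<epsilon>\<^sup>2\<close>-optimal, a Bayes act of the mixture with weight \<open>\<epsilon>\<close> on \<open>\<nu>\<close> has loss at most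
  \<open>V + \<epsilon>\<close> against \<open>\<nu>\<close>. All these mixtures have the same weak limit, so one act serves every \<open>\<nu>\<close>.\<close>

lemma exists_act_le_max_entropy:
  assumes sep: "separable_space (euclidean :: 'x topology)"
    and lsc: "bayes_lsc A L (mixtures \<Omega>)" and tight: "tight_model \<Omega>"
    and V: "max_derived_entropy A L \<Omega> = ereal V"
  obtains \<zeta> where "\<zeta> \<in> acts" "\<And>\<mu>. \<mu> \<in> priors \<Omega> \<Longrightarrow> derived_loss_law A L \<mu> \<zeta> \<le> ereal V"
proof -
  define \<epsilon> where "\<epsilon> n = 1 / real (Suc n)" for n
  have \<epsilon>: "0 < \<epsilon> n" "\<epsilon> n \<le> 1" for n
    by (auto simp: \<epsilon>_def)
  have \<epsilon>0: "\<epsilon> \<longlonglongrightarrow> 0"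
    unfolding \<epsilon>_def using LIMSEQ_inverse_real_of_nat by (simp add: inverse_eq_divide)
  have "\<exists>\<mu>\<in>priors \<Omega>. ereal (V - (\<epsilon> n)\<^sup>2) < derived_entropy A L \<mu>" for n
  proof -
    have "ereal (V - (\<epsilon> n)\<^sup>2) < max_derived_entropy A L \<Omega>"
      using V \<epsilon>(1)[of n] by simp
    then show ?thesis
      unfolding max_derived_entropy_def less_SUP_iff .
  qed
  then obtain \<mu> where \<mu>: "\<And>n. \<mu> n \<in> priors \<Omega>" "\<And>n. ereal (V - (\<epsilon> n)\<^sup>2) < derived_entropy A L (\<mu> n)"
    by metis
  have ent_le: "derived_entropy A L \<nu> \<le> ereal V" if "\<nu> \<in> priors \<Omega>" for \<nu>
    unfolding V[symmetric] max_derived_entropy_def using that by (rule SUP_upper)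
  have mean: "mean_dist \<nu> \<in> distributions borel" if "\<nu> \<in> priors \<Omega>" for \<nu>
    using mean_dist_distributions[OF priorsD[OF that]] .
  obtain r Q\<^sub>0 where r: "strict_mono (r :: nat \<Rightarrow> nat)" and Q: "Q\<^sub>0 \<in> distributions borel"
    and conv: "\<And>f :: 'x \<Rightarrow> real. continuous_on UNIV f \<Longrightarrow> bounded (range f) \<Longrightarrow>
      (\<lambda>n. \<integral>x. f x \<partial>mean_dist (\<mu> (r n))) \<longlonglongrightarrow> (\<integral>x. f x \<partial>Q\<^sub>0)"
  proof (rule prokhorov_subsequence[OF sep, of "\<lambda>n. mean_dist (\<mu> n)"])
    show "mean_dist (\<mu> n) \<in> distributions borel" for n
      using mean[OF \<mu>(1)] .
    fix \<delta> :: real assume "0 < \<delta>"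
    from tight[unfolded tight_model_def, rule_format, OF this]
    obtain K where K: "compact K" "\<forall>P\<in>\<Omega>. 1 - \<delta> < measure P K"
      by auto
    have "1 - \<delta> \<le> measure (mean_dist (\<mu> n)) K" for n
    proof (rule mean_dist_measure_ge[OF \<mu>(1)])
      show "K \<in> sets borel"
        using K(1) by (intro borel_closed compact_imp_closed)
      show "1 - \<delta> \<le> measure P K" if "P \<in> \<Omega>" for P
        using K(2) that by (simp add: less_imp_le)
    qed
    with K(1) show "\<exists>K. compact K \<and> (\<forall>n. 1 - \<delta> \<le> measure (mean_dist (\<mu> n)) K)"
      by blast
  qed blast
  \<comment> \<open>The unperturbed means only show that \<open>Q\<^sub>0\<close> is the limit of an
    admissible sequence. This fixes \<open>\<zeta>\<^sub>0\<close> before any \<open>\<nu>\<close>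
    is given.\<close>
  have "\<exists>Q. admissible_seq A L (mixtures \<Omega>) Q Q\<^sub>0"
    using mean_admissible[of "\<lambda>n. \<mu> (r n)", OF \<mu>(1) Q conv] by blast
  then obtain \<zeta>\<^sub>0 where \<zeta>\<^sub>0: "bayes_act borel A L Q\<^sub>0 \<zeta>\<^sub>0" "\<And>Q. admissible_seq A L (mixtures \<Omega>) Q Q\<^sub>0 \<Longrightarrow>
      \<exists>\<zeta>. (\<forall>n. bayes_act borel A L (Q n) (\<zeta> n)) \<and> (\<forall>P\<in>mixtures \<Omega>. loss L P \<zeta>\<^sub>0 \<le> liminf (\<lambda>n. loss L P (\<zeta> n)))"
    using lsc Q unfolding bayes_lsc_def by meson
  have act: "\<zeta>\<^sub>0 \<in> acts"
    using \<zeta>\<^sub>0(1) by (simp add: bayes_act_def)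
  have "derived_loss_law A L \<nu> \<zeta>\<^sub>0 \<le> ereal V" if \<nu>: "\<nu> \<in> priors \<Omega>" for \<nu>
  proof -
    define \<kappa> where "\<kappa> n = mixture (\<epsilon> n) (\<mu> (r n)) \<nu>" for n
    have \<kappa>: "\<kappa> n \<in> priors \<Omega>" for n
      unfolding \<kappa>_def using \<epsilon>[of n] by (intro mixture_priors \<mu> \<nu>) auto
    have "admissible_seq A L (mixtures \<Omega>) (\<lambda>n. mean_dist (\<kappa> n)) Q\<^sub>0"
    proof (rule mean_admissible[OF \<kappa> Q])
      fix f :: "'x \<Rightarrow> real" assume f: "continuous_on UNIV f" "bounded (range f)"
      have "(\<integral>x. f x \<partial>mean_dist (\<kappa> n))
          = (1 - \<epsilon> n) * (\<integral>x. f x \<partial>mean_dist (\<mu> (r n))) + \<epsilon> n * (\<integral>x. f x \<partial>mean_dist \<nu>)" for n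
        unfolding \<kappa>_def mean_dist_mixture[OF priorsD[OF \<mu>(1)] priorsD[OF \<nu>]] using \<epsilon>[of n] f
        by (intro integral_mixture[OF mean[OF \<mu>(1)] mean[OF \<nu>]] borel_measurable_continuous_onI) auto
      moreover have "(\<lambda>n. (1 - \<epsilon> n) * (\<integral>x. f x \<partial>mean_dist (\<mu> (r n))) + \<epsilon> n * (\<integral>x. f x \<partial>mean_dist \<nu>))
          \<longlonglongrightarrow> (1 - 0) * (\<integral>x. f x \<partial>Q\<^sub>0) + 0 * (\<integral>x. f x \<partial>mean_dist \<nu>)"
        by (intro tendsto_intros \<epsilon>0 conv f)
      ultimately show "(\<lambda>n. \<integral>x. f x \<partial>mean_dist (\<kappa> n)) \<longlonglongrightarrow> (\<integral>x. f x \<partial>Q\<^sub>0)"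
        by simp
    qed
    from \<zeta>\<^sub>0(2)[OF this] obtain \<zeta> where \<zeta>: "\<And>n. bayes_act borel A L (mean_dist (\<kappa> n)) (\<zeta> n)"
      and lim: "\<And>P. P \<in> mixtures \<Omega> \<Longrightarrow> loss L P \<zeta>\<^sub>0 \<le> liminf (\<lambda>n. loss L P (\<zeta> n))"
      by blast
    have \<zeta>act: "\<zeta> n \<in> acts" for n
      using \<zeta>[of n] by (simp add: bayes_act_def)
    have bound: "derived_loss_law A L \<nu> (\<zeta> n) \<le> ereal (V + \<epsilon> n)" for n
    proof -
      let ?N = "derived_loss_law A L \<nu> (\<zeta> n)" and ?M = "derived_loss_law A L (\<mu> (r n)) (\<zeta> n)"
      \<comment> \<open>The weight is indexed by \<open>n\<close> and the prior by
        \<open>r n\<close>; as \<open>n \<le> r n\<close>, the prior is at least as close to optimal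
        as the weight requires.\<close>
      have "\<epsilon> (r n) \<le> \<epsilon> n"
        using seq_suble[OF r, of n] by (simp add: \<epsilon>_def frac_le)
      then have "(\<epsilon> (r n))\<^sup>2 \<le> (\<epsilon> n)\<^sup>2"
        using \<epsilon>(1)[of "r n"] by (intro power_mono) auto
      then have "ereal (V - (\<epsilon> n)\<^sup>2) \<le> ereal (V - (\<epsilon> (r n))\<^sup>2)"
        by simp
      also have "\<dots> \<le> ?M"
        using \<mu>(2)[of "r n"] derived_entropy_bounds(4)[OF \<mu>(1) \<zeta>act] by (meson less_imp_le order_trans)
      finally have M: "ereal (1 - \<epsilon> n) * ereal (V - (\<epsilon> n)\<^sup>2) \<le> ereal (1 - \<epsilon> n) * ?M"
        using \<epsilon>(2)[of n] by (intro ereal_mult_left_mono) auto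
      have "ereal (\<epsilon> n) * ?N + ereal (1 - \<epsilon> n) * ereal (V - (\<epsilon> n)\<^sup>2)
          \<le> ereal (\<epsilon> n) * ?N + ereal (1 - \<epsilon> n) * ?M"
        by (rule add_left_mono[OF M])
      also have "\<dots> \<le> derived_loss_law A L (\<kappa> n) (\<zeta> n)"
        unfolding \<kappa>_def using \<epsilon>[of n] by (intro mixture_loss_ge \<mu> \<nu> \<zeta>act) auto
      also have "\<dots> \<le> ereal V"
        using derived_entropy_bounds(5)[OF \<kappa> \<zeta>] ent_le[OF \<kappa>] by (rule order_trans)
      finally have le: "ereal (\<epsilon> n) * ?N + ereal ((1 - \<epsilon> n) * (V - (\<epsilon> n)\<^sup>2)) \<le> ereal V"
        by simp
      have nn: "0 \<le> ?N"
        by (rule derived_loss_law_nonneg[OF \<nu> \<zeta>act])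
      \<comment> \<open>An infinite loss against \<open>\<nu>\<close> is impossible: its positive
        multiple, added to a finite number, stays below \<open>V\<close>.\<close>
      obtain x where x: "?N = ereal x"
        using le nn \<epsilon>(1)[of n] by (cases ?N) auto
      \<comment> \<open>Division by the weight \<open>\<epsilon> n\<close> follows, so the gap
        \<open>(\<epsilon> n)\<^sup>2\<close> has to be of smaller order than the weight.\<close>
      have "\<epsilon> n * x \<le> V - (1 - \<epsilon> n) * (V - (\<epsilon> n)\<^sup>2)"
        using le x by simp
      also have "\<dots> = \<epsilon> n * (V + (1 - \<epsilon> n) * \<epsilon> n)"
        by (simp add: algebra_simps power2_eq_square)
      finally have "x \<le> V + (1 - \<epsilon> n) * \<epsilon> n"
        using \<epsilon>(1)[of n] by simp
      also have "\<dots> \<le> V + 1 * \<epsilon> n"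
        using \<epsilon>[of n] by (intro add_left_mono mult_right_mono) auto
      finally show ?thesis using x by simp
    qed
    \<comment> \<open>Semicontinuity is stated for the basic loss; subtracting the constant of
      \<open>\<nu>\<close> translates the bound there and back.\<close>
    obtain c where c: "\<And>\<zeta>. \<zeta> \<in> acts \<Longrightarrow> derived_loss_law A L \<nu> \<zeta> = loss L (mean_dist \<nu>) \<zeta> - ereal c"
      using derived_loss_law_eq[OF \<nu>] by metis
    have "loss L (mean_dist \<nu>) (\<zeta> n) \<le> ereal (V + \<epsilon> n + c)" for n
      using bound[of n] unfolding c[OF \<zeta>act] by (simp add: ereal_minus_le)
    then have "liminf (\<lambda>n. loss L (mean_dist \<nu>) (\<zeta> n)) \<le> liminf (\<lambda>n. ereal (V + \<epsilon> n + c))"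
      by (intro Liminf_mono) simp
    also have "\<dots> = ereal (V + 0 + c)"
      by (intro lim_imp_Liminf tendsto_intros \<epsilon>0) simp
    finally have "loss L (mean_dist \<nu>) \<zeta>\<^sub>0 \<le> ereal (V + 0 + c)"
      using lim[OF mean_mixtures[OF \<nu>]] by (rule order_trans[rotated])
    then show ?thesis
      unfolding c[OF act] by (simp add: ereal_minus_le)
  qed
  with act show thesis by (rule that)
qed

end

theorem theorem9p1:
  fixes A :: "'a measure"
    and L :: "'x::metric_space \<Rightarrow> 'a \<Rightarrow> ereal"
    and \<Omega> :: "'x measure set"
  assumes "separable_space (euclidean :: 'x topology)"
    and "basic_game borel A L"
    and "\<Omega> \<subseteq> param_space A L" and "\<Omega> \<noteq> {}"
    and "bayes_lsc A L (mixtures \<Omega>)"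
    and "convex_dists (mixtures \<Omega>)"
    and "\<And>P. P \<in> mixtures \<Omega> \<Longrightarrow> \<exists>\<zeta>. bayes_act borel A L P \<zeta>"
    and "\<And>P. P \<in> mixtures \<Omega> \<Longrightarrow> finite_entropy borel A L P"
    and "(SUP P\<in>mixtures \<Omega>. gen_entropy A L P) < \<infinity>"
    and "\<exists>K::real. \<forall>\<omega>\<in>\<Omega>. gen_entropy A L \<omega> \<ge> ereal K"
    and "tight_model \<Omega>"
  shows "\<bar>max_derived_entropy A L \<Omega>\<bar> \<noteq> \<infinity> \<and>
    game_has_value (priors \<Omega>) (rand_acts borel A L) (derived_loss_law A L) (max_derived_entropy A L \<Omega>) \<and>
    (\<exists>\<zeta>'. minimax_act (priors \<Omega>) (rand_acts borel A L) (derived_loss_law A L) \<zeta>' \<and>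
       (SUP \<omega>\<in>\<Omega>. derived_loss A L \<omega> \<zeta>') =
         (INF \<zeta>\<in>rand_acts borel A L. SUP \<omega>\<in>\<Omega>. derived_loss A L \<omega> \<zeta>) \<and>
       (INF \<zeta>\<in>rand_acts borel A L. SUP \<omega>\<in>\<Omega>. derived_loss A L \<omega> \<zeta>) =
         (SUP \<mu>\<in>priors \<Omega>. INF a\<in>space A. derived_loss_law A L \<mu> (return A a)) \<and>
       (SUP \<mu>\<in>priors \<Omega>. INF a\<in>space A. derived_loss_law A L \<mu> (return A a)) =
         max_derived_entropy A L \<Omega>)"
proof -
  obtain K :: real where K: "\<And>\<omega>. \<omega> \<in> \<Omega> \<Longrightarrow> ereal K \<le> gen_entropy A L \<omega>"
    using assms(10) by blast
  have "\<exists>b::real. (SUP P\<in>mixtures \<Omega>. gen_entropy A L P) \<le> ereal b"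
    using assms(9) by (cases "SUP P\<in>mixtures \<Omega>. gen_entropy A L P") auto
  then obtain b :: real where b: "(SUP P\<in>mixtures \<Omega>. gen_entropy A L P) \<le> ereal b"
    by blast
  have up: "gen_entropy A L P \<le> ereal (max 0 b)" if "P \<in> mixtures \<Omega>" for P
    using order_trans[OF SUP_upper[OF that] b] by (rule order_trans) simp
  interpret robust_game A L \<Omega> K "max 0 b"
    using assms(2,3,7,8) K up by unfold_locales (auto simp: param_space_def)
  let ?D = "priors \<Omega>" and ?F = "derived_loss_law A L" and ?H = "max_derived_entropy A L \<Omega>"
  obtain \<omega> where "\<omega> \<in> \<Omega>" using assms(4) by blast
  then have \<delta>: "return weak_borel \<omega> \<in> ?D"
    using return_priors(1) model by blast
  have "0 \<le> ?H"
    \<comment> \<open>A point mass gives a prior with nonnegative derived entropy, so the supremum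
      is not taken over the empty set, where it would be \<open>-\<infinity>\<close>.\<close>
    unfolding max_derived_entropy_def using derived_entropy_bounds(1)[OF \<delta>] \<delta> by (rule SUP_upper2[rotated])
  moreover have "?H \<le> ereal (max 0 b - K)"
    unfolding max_derived_entropy_def by (intro SUP_least derived_entropy_bounds(2))
  ultimately obtain V where V: "?H = ereal V"
    by (cases ?H) auto
  obtain \<zeta>\<^sub>0 where \<zeta>\<^sub>0: "\<zeta>\<^sub>0 \<in> acts" "\<And>\<mu>. \<mu> \<in> ?D \<Longrightarrow> ?F \<mu> \<zeta>\<^sub>0 \<le> ereal V"
    using exists_act_le_max_entropy[OF assms(1,5,11) V] by metis
  \<comment> \<open>Randomization does not help against a fixed law, so the lower value over all
    acts equals the derived entropy over pure acts.\<close>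
  have pure: "(INF \<zeta>\<in>acts. ?F \<mu> \<zeta>) = derived_entropy A L \<mu>" if "\<mu> \<in> ?D" for \<mu>
  proof (rule antisym)
    show "(INF \<zeta>\<in>acts. ?F \<mu> \<zeta>) \<le> derived_entropy A L \<mu>"
      unfolding derived_entropy_def by (intro INF_greatest INF_lower return_rand_acts)
    show "derived_entropy A L \<mu> \<le> (INF \<zeta>\<in>acts. ?F \<mu> \<zeta>)"
      by (intro INF_greatest derived_entropy_bounds(4) that)
  qed
  then have supinf: "(SUP \<mu>\<in>?D. INF \<zeta>\<in>acts. ?F \<mu> \<zeta>) = ?H"
    unfolding max_derived_entropy_def by (intro SUP_cong refl)
  have le: "?H \<le> (SUP \<mu>\<in>?D. ?F \<mu> \<zeta>)" if "\<zeta> \<in> acts" for \<zeta>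
    unfolding max_derived_entropy_def
    using derived_entropy_bounds(4) that by (intro SUP_mono) blast
  have opt: "(SUP \<mu>\<in>?D. ?F \<mu> \<zeta>\<^sub>0) = ?H"
  proof (rule antisym)
    show "(SUP \<mu>\<in>?D. ?F \<mu> \<zeta>\<^sub>0) \<le> ?H"
      unfolding V by (rule SUP_least) (rule \<zeta>\<^sub>0(2))
  qed (rule le[OF \<zeta>\<^sub>0(1)])
  have infsup: "(INF \<zeta>\<in>acts. SUP \<mu>\<in>?D. ?F \<mu> \<zeta>) = ?H"
  proof (rule antisym)
    show "(INF \<zeta>\<in>acts. SUP \<mu>\<in>?D. ?F \<mu> \<zeta>) \<le> ?H"
      unfolding opt[symmetric] using \<zeta>\<^sub>0(1) by (rule INF_lower)
  qed (intro INF_greatest le)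
  have infsup': "(INF \<zeta>\<in>acts. SUP \<omega>\<in>\<Omega>. derived_loss A L \<omega> \<zeta>) = ?H"
    unfolding infsup[symmetric] by (intro INF_cong refl) (simp add: sup_derived_loss)
  have "minimax_act ?D acts ?F \<zeta>\<^sub>0"
    using \<zeta>\<^sub>0(1) opt infsup by (simp add: minimax_act_def)
  moreover have "(SUP \<omega>\<in>\<Omega>. derived_loss A L \<omega> \<zeta>\<^sub>0) = ?H"
    using sup_derived_loss[OF \<zeta>\<^sub>0(1)] opt by simp
  moreover have "(SUP \<mu>\<in>?D. INF a\<in>space A. ?F \<mu> (return A a)) = ?H"
    by (simp add: max_derived_entropy_def derived_entropy_def)
  moreover have "\<bar>?H\<bar> \<noteq> \<infinity>"
    by (simp add: V)
  ultimately show ?thesis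
    using supinf infsup infsup' unfolding game_has_value_def by auto
qed

end
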